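(* Let $\mathcal{H}$ denote either $\operatorname{Homeo}_0(\mathbf{T}^2)$ or $\operatorname{Homeo}_{0,\lambda}(\mathbf{T}^2)$ (the statement holds in both cases). Suppose that the rotation set of $f\in\mathcal{H}$ is $\epsilon$-upper-stable in $\mathcal{H}$ with $0<\epsilon<1$. Then $\rho_{\epsilon/2}(\tilde f)=\rho(\tilde f)$ for any lift $\tilde f$ of $f$. Moreover, for any lift $\tilde f$ and each $\epsilon/2$-pseudo-orbit $(\tilde x_i)_{i\in\mathbf{N}}$ of $\tilde f$ one has, for all $n\in\mathbf{N}$, $$d\big(\tilde x_n-\tilde x_0,\,n\rho(\tilde f)\big)\le\frac{16}{\pi\epsilon^2}\big(\operatorname{osc}(f)+2\big)+\epsilon.$$ If $(\tilde x_i)_{i\in\mathbf{N}}$ is an actual orbit of $\tilde f$ (i.e. $\tilde x_{i+1}=\tilde f(\tilde x_i)$), the bound can be replaced by $\frac{4}{\pi\epsilon^2}(\operatorname{osc}(f)+1)+\epsilon$.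
   Context: $\mathbf{T}^2=\mathbf{R}^2/\mathbf{Z}^2$; $\operatorname{Homeo}_0(\mathbf{T}^2)$ is the space of homeomorphisms of $\mathbf{T}^2$ isotopic to the identity, $\operatorname{Homeo}_{0,\lambda}(\mathbf{T}^2)$ its subspace of Lebesgue-area-preserving ones, both with the uniform distance $d_{C^0}$. For a lift $\tilde f$ of $f$ to $\mathbf{R}^2$, $\rho(\tilde f)$ is the set of all limits $\lim_k(\tilde f^{n_k}(z_k)-z_k)/n_k$ with $z_k\in\mathbf{R}^2$, $n_k\to\infty$; $\rho(f)$ is $\rho(\tilde f)$ modulo integer translations. $\rho(f)$ is $\epsilon$-upper-stable in $\mathcal{H}$ if every $g\in\mathcal{H}$ with $d_{C^0}(f,g)<\epsilon$ satisfies $\rho(g)\subset\rho(f)$ (modulo integer translations, i.e. the rotation set of the lift of $g$ closest to $\tilde f$ is contained in $\rho(\tilde f)$). An $\varepsilon$-pseudo-orbit of $\tilde f$ is a sequence $(x_i)$ in $\mathbf{R}^2$ with $\|\tilde f(x_i)-x_{i+1}\|<\varepsilon$ for all $i$. $\rho_\varepsilon(\tilde f)$ is the set of $v\in\mathbf{R}^2$ for which there are integers $n_k\to\infty$ and $\varepsilon$-pseudo-orbits $(x^k_i)_{0\le i\le n_k}$ of $\tilde f$ with $(x^k_{n_k}-x^k_0)/n_k\to v$. The oscillation of $f$ is $\operatorname{osc}(f)=\sup_{x,y\in\mathbf{R}^2}\|(\tilde f(x)-x)-(\tilde f(y)-y)\|$ for any lift $\tilde f$ (independent of the lift). $d(x,A)$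 is the Euclidean distance from a point to a set and $n\rho(\tilde f)=\{nv:v\in\rho(\tilde f)\}$. *)

theory Defs
  imports "HOL-Analysis.Analysis"
begin

text \<open>The plane R^2 is modelled by real \<times> real (Euclidean norm).
  A homeomorphism of T^2 isotopic to the identity is represented by its lifts:
  homeomorphisms of R^2 commuting with integer translations.\<close>

definition Zsq :: "(real \<times> real) set" where
  "Zsq = {(a, b). a \<in> \<int> \<and> b \<in> \<int>}"

definition torus_lift :: "(real \<times> real \<Rightarrow> real \<times> real) \<Rightarrow> bool" where
  "torus_lift F \<longleftrightarrow> (\<exists>G. homeomorphism UNIV UNIV F G) \<and>
     (\<forall>x. \<forall>k\<in>Zsq. F (x + k) = F x + k)"

text \<open>Lebesgue-area preserving (on the torus, equivalently for the lift on R^2).\<close>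
definition area_preserving :: "(real \<times> real \<Rightarrow> real \<times> real) \<Rightarrow> bool" where
  "area_preserving F \<longleftrightarrow>
     (\<forall>A\<in>sets lborel. emeasure lborel (F -` A) = emeasure lborel A)"

text \<open>Membership in H: area = False gives Homeo_0(T^2), area = True gives
  Homeo_{0,lambda}(T^2) (via lifts).\<close>
definition inH :: "bool \<Rightarrow> (real \<times> real \<Rightarrow> real \<times> real) \<Rightarrow> bool" where
  "inH area F \<longleftrightarrow> torus_lift F \<and> (area \<longrightarrow> area_preserving F)"

definition torus_dist :: "real \<times> real \<Rightarrow> real \<times> real \<Rightarrow> real" where
  "torus_dist a b = infdist (a - b) Zsq"

definition dC0 :: "(real \<times> real \<Rightarrow> real \<times> real) \<Rightarrow> (real \<times> real \<Rightarrow> real \<times> real) \<Rightarrow> real" where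
  "dC0 F G = (SUP x. torus_dist (F x) (G x))"

definition rot_set :: "(real \<times> real \<Rightarrow> real \<times> real) \<Rightarrow> (real \<times> real) set" where
  "rot_set F = {v. \<exists>(z :: nat \<Rightarrow> real \<times> real) (n :: nat \<Rightarrow> nat).
      filterlim n at_top sequentially \<and>
      ((\<lambda>k. (1 / real (n k)) *\<^sub>R ((F ^^ n k) (z k) - z k)) \<longlonglongrightarrow> v)}"

definition pseudo_orbit_upto ::
  "(real \<times> real \<Rightarrow> real \<times> real) \<Rightarrow> real \<Rightarrow> nat \<Rightarrow> (nat \<Rightarrow> real \<times> real) \<Rightarrow> bool" where
  "pseudo_orbit_upto F e n x \<longleftrightarrow> (\<forall>i<n. norm (F (x i) - x (Suc i)) < e)"

definition pseudo_orbit ::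
  "(real \<times> real \<Rightarrow> real \<times> real) \<Rightarrow> real \<Rightarrow> (nat \<Rightarrow> real \<times> real) \<Rightarrow> bool" where
  "pseudo_orbit F e x \<longleftrightarrow> (\<forall>i. norm (F (x i) - x (Suc i)) < e)"

definition pseudo_rot_set ::
  "real \<Rightarrow> (real \<times> real \<Rightarrow> real \<times> real) \<Rightarrow> (real \<times> real) set" where
  "pseudo_rot_set e F = {v. \<exists>(n :: nat \<Rightarrow> nat) (x :: nat \<Rightarrow> nat \<Rightarrow> real \<times> real).
      filterlim n at_top sequentially \<and>
      (\<forall>k. pseudo_orbit_upto F e (n k) (x k)) \<and>
      ((\<lambda>k. (1 / real (n k)) *\<^sub>R (x k (n k) - x k 0)) \<longlonglongrightarrow> v)}"

definition osc :: "(real \<times> real \<Rightarrow> real \<times> real) \<Rightarrow> real" where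
  "osc F = (SUP p. norm ((F (fst p) - fst p) - (F (snd p) - snd p)))"

text \<open>rho(f) is eps-upper-stable in H: every g in H with d_C0(f,g) < eps has
  (for a lift of g closest to F in uniform distance) rotation set inside rot_set F.\<close>
definition upper_stable ::
  "bool \<Rightarrow> (real \<times> real \<Rightarrow> real \<times> real) \<Rightarrow> real \<Rightarrow> bool" where
  "upper_stable area F eps \<longleftrightarrow>
     (\<forall>G. inH area G \<and> dC0 F G < eps \<longrightarrow>
        (\<exists>k\<in>Zsq.
           (\<forall>k'\<in>Zsq. (SUP x. norm (F x - (G x + k))) \<le> (SUP x. norm (F x - (G x + k')))) \<and>
           rot_set (\<lambda>x. G x + k) \<subseteq> rot_set F))"

end

theory Submission
  imports Defs
begin

text \<open>
  Periodic pseudo-orbits can be realised by perturbation. If \<open>y\<^sub>0, \<dots>, y\<^sub>q = y\<^sub>0 + k\<close> has jumps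
  smaller than \<open>\<epsilon>/2\<close>, except for a last one smaller than \<open>\<epsilon>\<close>, choose an integer vector \<open>w\<close> at almost
  45 degrees from the last jump. In the orthogonal frame of \<open>w\<close> every jump then has both components
  smaller than \<open>\<epsilon>/sqrt 2\<close>, so after a small perturbation making the points generic two shears, along
  \<open>w\<close> and along its normal, carry \<open>F y\<^sub>l\<close> to \<open>y\<^sub>l\<^sub>+\<^sub>1\<close> and displace no point by \<open>\<epsilon>\<close> or more. Shears of the
  torus preserve area, so upper stability gives \<open>k/q \<in> \<rho>(F)\<close>.

  A pseudo-orbit is cut greedily: from \<open>x\<^sub>i\<close> pass to the last \<open>x\<^sub>j\<close> close to \<open>x\<^sub>i\<close> on the torus, make one
  step, and start again. Each block is nearly a loop, with displacement in \<open>(j - i) \<rho>(F)\<close>, and the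
  starting points of the blocks are separated, so an area estimate bounds their number.

  Adding up the blocks uses the convexity of \<open>\<rho>(F)\<close> (Misiurewicz and Ziemian): the displacement set \<open>K\<^sub>N\<close>
  of \<open>F\<^sup>N\<close> contains a point within a universal distance of the midpoint of any two of its points, hence
  the convex hull of \<open>K\<^sub>N\<close> stays within a universal distance of \<open>K\<^sub>N\<close>, and \<open>\<rho>(F)\<close> is the intersection of the
  sets \<open>conv K\<^sub>N / N\<close>.
\<close>

section \<open>Convexity of the rotation set\<close>

text \<open>The difference \<open>\<gamma> s - \<gamma> t\<close> omits \<open>k\<close>, so the loop that it traces along two sides of the square
  (the diagonal being mapped to \<open>0\<close>) does not wind around \<open>k\<close>. But this loop is symmetric about
  \<open>c = (\<gamma> 0 - \<gamma> 1) / 2\<close>, hence winds an odd number of times around \<open>c\<close>, and \<open>k\<close> is too close to \<open>c\<close>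
  for the two winding numbers to differ. They appear below through the logarithms \<open>L\<close> and \<open>M\<close>.\<close>

lemma self_avoiding_arc_near_midpoint:
  fixes \<gamma> :: "real \<Rightarrow> complex" and k :: complex
  assumes cont: "continuous_on {0..1} \<gamma>"
    and avoid: "\<And>s t. s \<in> {0..1} \<Longrightarrow> t \<in> {0..1} \<Longrightarrow> \<gamma> s - \<gamma> t \<noteq> k"
    and far: "\<And>t. t \<in> {0..1} \<Longrightarrow> norm ((\<gamma> 0 - \<gamma> 1) / 2 - k) < norm (\<gamma> t - (\<gamma> 0 + \<gamma> 1) / 2)"
  shows False
proof -
  define c where "c = (\<gamma> 0 - \<gamma> 1) / 2"
  define Q where "Q = ({0..1} :: real set) \<times> ({0..1} :: real set)"
  define f where "f = (\<lambda>p. \<gamma> (fst p) - \<gamma> (snd p) - k)"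
  have "continuous_on Q f"
    unfolding f_def Q_def
    by (intro continuous_intros continuous_on_compose2[OF cont]) auto
  moreover have "contractible Q"
    unfolding Q_def by (intro convex_imp_contractible convex_Times) auto
  moreover have "f p \<noteq> 0" if "p \<in> Q" for p
    using avoid[of "fst p" "snd p"] that unfolding f_def Q_def by auto
  ultimately obtain g where g: "continuous_on Q g" "\<And>p. p \<in> Q \<Longrightarrow> f p = exp (g p)"
    using continuous_logarithm_on_contractible by metis
  \<comment> \<open>Two logarithms of the same number differ by a multiple of
    \<open>2 * pi * \<i>\<close>, so a continuous logarithm of a constant has discrete range on a
    connected set and is constant.\<close>
  have const: "\<exists>z. \<forall>t\<in>{0..1}. u t = z"
    if u: "continuous_on {0..1} u" and e: "\<And>t. t \<in> {0..1} \<Longrightarrow> exp (u t) = b"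
    for u :: "real \<Rightarrow> complex" and b
  proof -
    have "u constant_on {0..1}"
    proof (rule continuous_discrete_range_constant[OF _ u])
      show "connected {0..1::real}" by simp
      fix x :: real assume x: "x \<in> {0..1}"
      show "\<exists>e>0. \<forall>y. y \<in> {0..1} \<and> u y \<noteq> u x \<longrightarrow> e \<le> norm (u y - u x)"
      proof (intro exI[of _ "2 * pi"] conjI allI impI)
        fix y assume y: "y \<in> {0..1} \<and> u y \<noteq> u x"
        then have "exp (u y) = exp (u x)" using e x by simp
        then obtain n :: int where n: "u y = u x + of_int (2 * n) * pi * \<i>"
          using exp_eq by metis
        then have "n \<noteq> 0" using y by auto
        have "norm (u y - u x) = 2 * \<bar>real_of_int n\<bar> * pi"
          using n by (simp add: norm_mult)
        also have "\<dots> \<ge> 2 * 1 * pi"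
          using \<open>n \<noteq> 0\<close> by (intro mult_mono) auto
        finally show "2 * pi \<le> norm (u y - u x)" by simp
      qed simp
    qed
    then show ?thesis by (auto simp: constant_on_def)
  qed
  \<comment> \<open>Keeps the quotients below inside the domain of continuity of \<open>Ln\<close>:
    a nonpositive ratio would put \<open>p\<close> and \<open>q\<close> on opposite sides of the
    origin, at distance at least \<open>norm p\<close>.\<close>
  have half: "q / p \<notin> \<real>\<^sub>\<le>\<^sub>0" if "norm (p - q) < norm p" for p q :: complex
  proof
    assume "q / p \<in> \<real>\<^sub>\<le>\<^sub>0"
    then obtain r where r: "q / p = of_real r" "r \<le> 0"
      by (auto simp: nonpos_Reals_def)
    moreover have "p \<noteq> 0" using that by auto
    ultimately have "p - q = of_real (1 - r) * p" by (simp add: field_simps)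
    then have "norm (p - q) = (1 - r) * norm p"
      using r(2) by (simp add: norm_mult del: of_real_diff)
    moreover have "(1 - r) * norm p \<ge> 1 * norm p"
      using r(2) by (intro mult_right_mono) auto
    ultimately show False using that by simp
  qed
  \<comment> \<open>\<open>a\<close> and \<open>b\<close> are the values of the difference on the
    sides \<open>(0, t)\<close> and \<open>(t, 1)\<close> of the square; each is the reflection of
    the other in \<open>c\<close>.\<close>
  define a where "a = (\<lambda>t. \<gamma> 0 - \<gamma> t)"
  define b where "b = (\<lambda>t. \<gamma> t - \<gamma> 1)"
  have ba: "b t - c = - (a t - c)" for t
    unfolding a_def b_def c_def by (simp add: field_simps)
  have ca: "continuous_on {0..1} a" and cb: "continuous_on {0..1} b"
    unfolding a_def b_def using cont by (auto intro!: continuous_intros)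
  have fa: "norm (c - k) < norm (a t - c)" if "t \<in> {0..1}" for t
  proof -
    have "a t - c = - (\<gamma> t - (\<gamma> 0 + \<gamma> 1) / 2)"
      unfolding a_def c_def by (simp add: field_simps)
    then have "norm (a t - c) = norm (\<gamma> t - (\<gamma> 0 + \<gamma> 1) / 2)"
      by (metis norm_minus_cancel)
    then show ?thesis using far[OF that] by (simp only: c_def)
  qed
  have fb: "norm (c - k) < norm (b t - c)" if "t \<in> {0..1}" for t
    using fa[OF that] unfolding ba norm_minus_cancel .
  have ne: "(a t - k) / (a t - c) \<notin> \<real>\<^sub>\<le>\<^sub>0" "(b t - k) / (b t - c) \<notin> \<real>\<^sub>\<le>\<^sub>0"
    if "t \<in> {0..1}" for t
    by (intro half; use fa[OF that] fb[OF that] in \<open>simp add: norm_minus_commute[of k c]\<close>)+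
  have ac: "a t \<noteq> c" "b t \<noteq> c" "a t \<noteq> k" "b t \<noteq> k" if "t \<in> {0..1}" for t
    using fa[OF that] fb[OF that] norm_minus_commute[of c k] by auto
  \<comment> \<open>On each side \<open>g\<close> is a logarithm of the distance vector to
    \<open>k\<close>. The principal \<open>Ln\<close> of the quotient turns it into a continuous
    logarithm of the vector to \<open>c\<close>.\<close>
  define L where "L = (\<lambda>t. g (0, t) - Ln ((a t - k) / (a t - c)))"
  define M where "M = (\<lambda>t. g (t, 1) - Ln ((b t - k) / (b t - c)))"
  have cL: "continuous_on {0..1} L" unfolding L_def
    by (intro continuous_intros continuous_on_compose2[OF g(1)] ca ne)
       (use ac in \<open>auto simp: Q_def\<close>)
  have cM: "continuous_on {0..1} M" unfolding M_def
    by (intro continuous_intros continuous_on_compose2[OF g(1)] cb ne)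
       (use ac in \<open>auto simp: Q_def\<close>)
  have eL: "exp (L t) = a t - c" if t: "t \<in> {0..1}" for t
  proof -
    have "exp (g (0, t)) = a t - k"
      using g(2)[of "(0, t)"] t by (simp add: Q_def f_def a_def)
    then show ?thesis using ac[OF t] by (simp add: L_def exp_diff exp_Ln)
  qed
  have eM: "exp (M t) = b t - c" if t: "t \<in> {0..1}" for t
  proof -
    have "exp (g (t, 1)) = b t - k"
      using g(2)[of "(t, 1)"] t by (simp add: Q_def f_def b_def)
    then show ?thesis using ac[OF t] by (simp add: M_def exp_diff exp_Ln)
  qed
  have eML: "exp (M t - L t) = -1" if "t \<in> {0..1}" for t
  proof -
    have "exp (M t - L t) = - (a t - c) / (a t - c)"
      by (simp only: exp_diff eL[OF that] eM[OF that] ba)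
    also have "\<dots> = -1" using ac(1)[OF that] by (simp only: minus_divide_left[symmetric]) simp
    finally show ?thesis .
  qed
  obtain m where m: "\<And>t. t \<in> {0..1} \<Longrightarrow> M t - L t = m"
    using const[OF continuous_on_diff[OF cM cL] eML] by blast
  have em: "exp m = -1" using m[of 0] eML[of 0] by simp
  obtain d where d: "\<And>t. t \<in> {0..1} \<Longrightarrow> g (t, t) = d"
  proof -
    have "continuous_on {0..1} (\<lambda>t. g (t, t))"
      by (intro continuous_on_compose2[OF g(1)] continuous_intros) (auto simp: Q_def)
    moreover have "exp (g (t, t)) = - k" if "t \<in> {0..1}" for t
      using g(2)[of "(t, t)"] that by (simp add: Q_def f_def)
    ultimately show ?thesis using const[of "\<lambda>t. g (t, t)" "- k"] that by blast
  qed
  \<comment> \<open>The sides meet at the corner \<open>(0, 1)\<close>, and the two diagonal corners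
    carry the same logarithm \<open>d\<close>. So \<open>m\<close> is both \<open>L 1 - L 0\<close>
    and \<open>L 0 - L 1\<close>, which forces \<open>m = 0\<close> against
    \<open>exp m = -1\<close>.\<close>
  have "M 0 = L 1" unfolding M_def L_def a_def b_def by simp
  moreover have "M 1 = L 0" unfolding M_def L_def using d[of 0] d[of 1] by (simp add: a_def b_def)
  ultimately have "m = - m"
    using m[of 0] m[of 1] minus_diff_eq[of "L 1" "L 0"] by simp
  then have "m = 0" by simp
  then show False using em by simp
qed

section \<open>Integer translations and lifts of torus homeomorphisms\<close>

lemma Zsq_0 [simp]: "0 \<in> Zsq"
  by (simp add: Zsq_def zero_prod_def)

lemma Zsq_uminus: "k \<in> Zsq \<Longrightarrow> - k \<in> Zsq"
  by (auto simp: Zsq_def)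

lemma Zsq_add: "k \<in> Zsq \<Longrightarrow> l \<in> Zsq \<Longrightarrow> k + l \<in> Zsq"
  by (auto simp: Zsq_def)

lemma Zsq_norm_ge_1:
  assumes "k \<in> Zsq" "k \<noteq> 0"
  shows "1 \<le> norm k"
proof -
  obtain a b where k: "k = (a, b)" "a \<in> \<int>" "b \<in> \<int>"
    using assms(1) by (auto simp: Zsq_def)
  then have "1 \<le> \<bar>a\<bar> \<or> 1 \<le> \<bar>b\<bar>"
    using assms(2) Ints_nonzero_abs_ge1 by (auto simp: zero_prod_def)
  moreover have "\<bar>a\<bar> \<le> norm k" "\<bar>b\<bar> \<le> norm k"
    using norm_fst_le[of a b] norm_snd_le[of b a] by (auto simp: k)
  ultimately show ?thesis by linarith
qed

lemma Zsq_near: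
  obtains k where "k \<in> Zsq" "norm (z - k) < 1"
proof -
  define a b where "a = real_of_int (round (fst z))" and "b = real_of_int (round (snd z))"
  have "\<bar>fst z - a\<bar> \<le> 1 / 2" "\<bar>snd z - b\<bar> \<le> 1 / 2"
    unfolding a_def b_def using of_int_round_abs_le by (metis abs_minus_commute)+
  then have "(fst z - a)\<^sup>2 \<le> (1 / 2)\<^sup>2" "(snd z - b)\<^sup>2 \<le> (1 / 2)\<^sup>2"
    by (auto intro!: power2_le_iff_abs_le[THEN iffD2])
  then have "(fst z - a)\<^sup>2 + (snd z - b)\<^sup>2 < 1" by (simp add: power2_eq_square)
  then have "norm (z - (a, b)) < 1"
    by (simp add: norm_prod_def)
  moreover have "(a, b) \<in> Zsq" by (simp add: Zsq_def a_def b_def)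
  ultimately show ?thesis using that by blast
qed

lemma torus_lift_add:
  assumes "torus_lift F" "k \<in> Zsq"
  shows "F (x + k) = F x + k"
  using assms unfolding torus_lift_def by blast

lemma torus_lift_continuous:
  assumes "torus_lift F"
  shows "continuous_on S F"
  using assms continuous_on_subset[OF homeomorphism_cont1] unfolding torus_lift_def by blast

lemma torus_lift_inj:
  assumes "torus_lift F"
  shows "inj F"
proof -
  obtain G where "homeomorphism UNIV UNIV F G" using assms by (auto simp: torus_lift_def)
  then show ?thesis by (intro inj_on_inverseI[of UNIV G F]) (simp add: homeomorphism_apply1)
qed

lemma torus_lift_id: "torus_lift id"
  using homeomorphism_ident[of UNIV] by (auto simp: torus_lift_def id_def)

lemma torus_lift_comp:
  assumes "torus_lift F" "torus_lift G"
  shows "torus_lift (F \<circ> G)"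
proof -
  obtain F' G' where "homeomorphism UNIV UNIV F F'" "homeomorphism UNIV UNIV G G'"
    using assms by (auto simp: torus_lift_def)
  then have "homeomorphism UNIV UNIV (F \<circ> G) (G' \<circ> F')" by (rule homeomorphism_compose[rotated])
  then show ?thesis
    unfolding torus_lift_def using torus_lift_add assms by (simp add: exI)
qed

lemma torus_lift_funpow:
  assumes "torus_lift F"
  shows "torus_lift (F ^^ n)"
  by (induction n) (simp_all only: funpow.simps torus_lift_comp assms torus_lift_id)

section \<open>Displacement sets and their midpoints\<close>

definition displacements :: "(real \<times> real \<Rightarrow> real \<times> real) \<Rightarrow> (real \<times> real) set" where
  "displacements F = range (\<lambda>z. F z - z)"

text \<open>The displacement is invariant under integer translations and every point has a lattice
  point within distance 1. Restricting to a compact ball yields compactness of the displacement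
  set.\<close>

lemma displacements_eq_image:
  assumes "torus_lift F"
  shows "displacements F = (\<lambda>z. F z - z) ` cball 0 1"
proof -
  have "F z - z \<in> (\<lambda>z. F z - z) ` cball 0 1" for z
  proof -
    obtain k where k: "k \<in> Zsq" "norm (z - k) < 1" using Zsq_near by blast
    have "F (z + - k) = F z + - k"
      by (rule torus_lift_add[OF assms Zsq_uminus[OF k(1)]])
    then have "F z - z = F (z - k) - (z - k)" by simp
    then show ?thesis using k(2) by (intro image_eqI[of _ _ "z - k"]) auto
  qed
  then show ?thesis unfolding displacements_def by blast
qed

lemma compact_displacements:
  assumes "torus_lift F"
  shows "compact (displacements F)"
  unfolding displacements_eq_image[OF assms]
  by (rule compact_continuous_image[OF continuous_on_diff[OF torus_lift_continuous[OF assms] continuous_on_id]])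
     simp

text \<open>After an integer translation the two base points are at distance less than 1. The image
  of the segment joining them cannot meet its translate by a nonzero \<open>m\<close> in
  \<open>Zsq\<close>, since the segment is shorter than \<open>m\<close>. Hence the arc passes
  within 1 of the midpoint of its endpoints, and passing from the point to its displacement costs at
  most 1 more.\<close>

lemma displacements_near_midpoint:
  assumes F: "torus_lift F" and a: "a \<in> displacements F" and b: "b \<in> displacements F"
  shows "\<exists>c\<in>displacements F. norm (c - (1 / 2) *\<^sub>R (a + b)) \<le> 2"
proof -
  obtain z1 z where z1: "a = F z1 - z1" and z: "b = F z - z"
    using a b by (auto simp: displacements_def)
  obtain k where k: "k \<in> Zsq" "norm (z - z1 - k) < 1" using Zsq_near by blast
  define z2 where "z2 = z + - k"
  have z2: "b = F z2 - z2" "norm (z2 - z1) < 1"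
    using torus_lift_add[OF F Zsq_uminus[OF k(1)], of z] k(2)
    by (auto simp: z2_def z algebra_simps)
  define s where "s = (\<lambda>t::real. z1 + t *\<^sub>R (z2 - z1))"
  define G where "G = (\<lambda>t. F (s t))"
  have "\<exists>t\<in>{0..1}. norm (G t - (1 / 2) *\<^sub>R (G 0 + G 1)) \<le> 1"
  proof (rule ccontr)
    assume "\<not> ?thesis"
    then have far: "1 < norm (G t - (1 / 2) *\<^sub>R (G 0 + G 1))" if "t \<in> {0..1}" for t
      using that by (meson not_le)
    define cx where "cx = (\<lambda>p::real \<times> real. Complex (fst p) (snd p))"
    have cx: "cx (p - q) = cx p - cx q" "cx (p + q) = cx p + cx q"
      "cx (r *\<^sub>R p) = of_real r * cx p" "norm (cx p) = norm p" "cx p = cx q \<longleftrightarrow> p = q" for p q r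
      by (auto simp: cx_def complex_eq_iff norm_prod_def cmod_def prod_eq_iff)
    obtain m where m: "m \<in> Zsq" "norm ((1 / 2) *\<^sub>R (G 0 - G 1) - m) < 1" using Zsq_near by blast
    \<comment> \<open>If the lattice point near half the chord were \<open>0\<close>, the chord
      would be so short that the endpoint \<open>G 0\<close> itself lies within 1 of the
      midpoint.\<close>
    have "m \<noteq> 0"
    proof
      assume "m = 0"
      moreover have "G 0 - (1 / 2) *\<^sub>R (G 0 + G 1) = (1 / 2) *\<^sub>R (G 0 - G 1)"
        by (simp add: algebra_simps prod_eq_iff)
      ultimately show False using far[of 0] m(2) by simp
    qed
    have contG: "continuous_on {0..1} G"
      unfolding G_def s_def
      by (intro continuous_on_compose2[OF torus_lift_continuous[OF F, of UNIV]] continuous_intros) auto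
    show False
    proof (rule self_avoiding_arc_near_midpoint[of "\<lambda>t. cx (G t)" "cx m"])
      show "continuous_on {0..1} (\<lambda>t. cx (G t))"
        unfolding cx_def complex_eq_cancel_iff2 Complex_eq
        by (intro continuous_intros contG)
      fix t u :: real assume tu: "t \<in> {0..1}" "u \<in> {0..1}"
      show "cx (G t) - cx (G u) \<noteq> cx m"
      proof
        assume "cx (G t) - cx (G u) = cx m"
        then have "G t - G u = m" by (simp only: cx(1,5) flip: cx(1))
        then have "G t = G u + m" by (simp add: algebra_simps)
        then have "F (s t) = F (s u + m)" by (simp add: G_def torus_lift_add[OF F m(1)])
        then have "s t = s u + m" using torus_lift_inj[OF F] by (auto dest: injD)
        then have "m = (t - u) *\<^sub>R (z2 - z1)" by (simp add: s_def algebra_simps)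
        then have "norm m = \<bar>t - u\<bar> * norm (z2 - z1)" by simp
        also have "\<dots> \<le> 1 * norm (z2 - z1)" using tu by (intro mult_right_mono) auto
        finally show False using z2(2) Zsq_norm_ge_1[OF m(1) \<open>m \<noteq> 0\<close>] by simp
      qed
    next
      fix t :: real assume t: "t \<in> {0..1}"
      have "(cx (G 0) - cx (G 1)) / 2 - cx m = cx ((1 / 2) *\<^sub>R (G 0 - G 1) - m)"
        by (simp add: cx field_simps)
      moreover have "cx (G t) - (cx (G 0) + cx (G 1)) / 2 = cx (G t - (1 / 2) *\<^sub>R (G 0 + G 1))"
        by (simp add: cx field_simps)
      ultimately show "norm ((cx (G 0) - cx (G 1)) / 2 - cx m)
          < norm (cx (G t) - (cx (G 0) + cx (G 1)) / 2)"
        using far[OF t] m(2) by (simp only: cx(4))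
    qed
  qed
  then obtain t where t: "t \<in> {0..1}" "norm (G t - (1 / 2) *\<^sub>R (G 0 + G 1)) \<le> 1" by blast
  have "norm ((1 / 2 - t) *\<^sub>R (z2 - z1)) \<le> 1 * norm (z2 - z1)"
    unfolding norm_scaleR using t(1) by (intro mult_right_mono) auto
  moreover have "F (s t) - s t - (1 / 2) *\<^sub>R (a + b)
      = (G t - (1 / 2) *\<^sub>R (G 0 + G 1)) + (1 / 2 - t) *\<^sub>R (z2 - z1)"
    unfolding G_def s_def z1 z2 by (simp add: prod_eq_iff field_simps)
  ultimately have "norm (F (s t) - s t - (1 / 2) *\<^sub>R (a + b)) \<le> 2"
    using t(2) z2(2) norm_triangle_ineq[of "G t - (1 / 2) *\<^sub>R (G 0 + G 1)" "(1 / 2 - t) *\<^sub>R (z2 - z1)"]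
    by (simp only:)
  moreover have "F (s t) - s t \<in> displacements F" by (simp add: displacements_def)
  ultimately show ?thesis by blast
qed

section \<open>Approximate convexity of compact sets\<close>

text \<open>Let \<open>s\<close> be the largest distance to \<open>K\<close> of points on segments
  with ends in \<open>K\<close>. A point with parameter \<open>t \<le> 1 / 2\<close> is the midpoint
  of \<open>a\<close> and the point with parameter \<open>2 * t\<close>; replacing the latter by a
  nearest point of \<open>K\<close> gives \<open>s \<le> s / 2 + C\<close>.\<close>

lemma segment_near_if_midpoints_near:
  fixes K :: "'a::euclidean_space set"
  assumes K: "compact K" and mid: "\<And>a b. a \<in> K \<Longrightarrow> b \<in> K \<Longrightarrow> \<exists>c\<in>K. norm (c - (1 / 2) *\<^sub>R (a + b)) \<le> C"
    and ab: "a \<in> K" "b \<in> K" and t: "0 \<le> t" "t \<le> 1"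
  shows "\<exists>c\<in>K. norm (c - ((1 - t) *\<^sub>R a + t *\<^sub>R b)) \<le> 2 * C"
proof -
  have ne: "K \<noteq> {}" using ab by auto
  define X where "X = {((1 - t) *\<^sub>R a + t *\<^sub>R b) |a b t. a \<in> K \<and> b \<in> K \<and> 0 \<le> t \<and> t \<le> 1}"
  have XK: "X \<subseteq> convex hull K"
  proof
    fix x assume "x \<in> X"
    then obtain a b t where x: "x = (1 - t) *\<^sub>R a + t *\<^sub>R b" "a \<in> K" "b \<in> K" "0 \<le> t" "t \<le> 1"
      unfolding X_def by auto
    show "x \<in> convex hull K"
      unfolding x(1) by (rule convexD[OF convex_convex_hull]) (use x in \<open>auto simp: hull_inc\<close>)
  qed
  have "bounded (convex hull K)" using K by (simp add: compact_imp_bounded bounded_convex_hull)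
  then obtain B where B: "\<And>x y. x \<in> convex hull K \<Longrightarrow> y \<in> convex hull K \<Longrightarrow> dist x y \<le> B"
    unfolding bounded_two_points by blast
  \<comment> \<open>The supremum must be finite before \<open>s \<le> s / 2 + C\<close> can be
    solved for \<open>s\<close>.\<close>
  have bdd: "bdd_above ((\<lambda>x. infdist x K) ` X)"
  proof (rule bdd_aboveI2)
    fix x assume "x \<in> X"
    then have "x \<in> convex hull K" using XK by auto
    then have "dist x a \<le> B" using B ab(1) by (simp add: hull_inc)
    then show "infdist x K \<le> B" using infdist_le2[OF ab(1)] by blast
  qed
  define s where "s = (SUP x\<in>X. infdist x K)"
  have up: "infdist x K \<le> s" if "x \<in> X" for x
    unfolding s_def by (rule cSUP_upper[OF that bdd])
  have step: "infdist ((1 - t) *\<^sub>R a + t *\<^sub>R b) K \<le> s / 2 + C"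
    if h: "a \<in> K" "b \<in> K" "0 \<le> t" "t \<le> 1 / 2" for a b t
  proof -
    define x where "x = (1 - 2 * t) *\<^sub>R a + (2 * t) *\<^sub>R b"
    have "x \<in> X" unfolding X_def x_def using that by (intro CollectI exI[of _ a] exI[of _ b] exI[of _ "2 * t"]) simp
    obtain y where y: "y \<in> K" "infdist x K = dist x y"
      using infdist_attains_inf[OF compact_imp_closed[OF K] ne] by blast
    have "dist x y \<le> s" using y(2) up[OF \<open>x \<in> X\<close>] by simp
    obtain c where c: "c \<in> K" "norm (c - (1 / 2) *\<^sub>R (a + y)) \<le> C"
      using mid[OF h(1) y(1)] by blast
    have "(1 - t) *\<^sub>R a = (1 / 2) *\<^sub>R ((1 - 2 * t) *\<^sub>R a) + (1 / 2) *\<^sub>R a"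
      by (simp add: scaleR_left_distrib[symmetric] field_simps)
    then have "(1 - t) *\<^sub>R a + t *\<^sub>R b - c = (1 / 2) *\<^sub>R (x - y) - (c - (1 / 2) *\<^sub>R (a + y))"
      by (simp add: x_def scaleR_right_distrib scaleR_right_diff_distrib)
    then have "dist ((1 - t) *\<^sub>R a + t *\<^sub>R b) c \<le> norm ((1 / 2) *\<^sub>R (x - y)) + norm (c - (1 / 2) *\<^sub>R (a + y))"
      by (metis dist_norm norm_triangle_ineq4)
    also have "\<dots> \<le> s / 2 + C" using c(2) \<open>dist x y \<le> s\<close> by (simp add: dist_norm)
    finally show ?thesis by (rule infdist_le2[OF c(1)])
  qed
  have "s \<le> s / 2 + C" unfolding s_def
  proof (rule cSUP_least)
    have "(1 - 0) *\<^sub>R a + 0 *\<^sub>R a \<in> X" unfolding X_def using ab(1) by force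
    then show "X \<noteq> {}" by auto
    fix x assume "x \<in> X"
    then obtain a b t where x: "x = (1 - t) *\<^sub>R a + t *\<^sub>R b" "a \<in> K" "b \<in> K" "0 \<le> t" "t \<le> 1"
      unfolding X_def by auto
    show "infdist x K \<le> (SUP x\<in>X. infdist x K) / 2 + C"
      using step[of a b t] step[of b a "1 - t"] x
      unfolding s_def[symmetric] by (cases "t \<le> 1 / 2") (auto simp: add.commute)
  qed
  then have "s \<le> 2 * C" by simp
  moreover have "(1 - t) *\<^sub>R a + t *\<^sub>R b \<in> X" unfolding X_def using ab t by blast
  ultimately have "infdist ((1 - t) *\<^sub>R a + t *\<^sub>R b) K \<le> 2 * C" using up by force
  then show ?thesis
    using infdist_attains_inf[OF compact_imp_closed[OF K] ne, of "(1 - t) *\<^sub>R a + t *\<^sub>R b"]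
    by (metis dist_norm norm_minus_commute)
qed

text \<open>By Caratheodory \<open>DIM('a) + 1\<close> points of \<open>K\<close> suffice. Adding
  one point at a time, each addition replaces a segment ending in the smaller hull by one ending in
  \<open>K\<close> and costs \<open>2 * C\<close>.\<close>

lemma convex_hull_near_if_midpoints_near:
  fixes K :: "'a::euclidean_space set"
  assumes K: "compact K" and mid: "\<And>a b. a \<in> K \<Longrightarrow> b \<in> K \<Longrightarrow> \<exists>c\<in>K. norm (c - (1 / 2) *\<^sub>R (a + b)) \<le> C"
    and x: "x \<in> convex hull K" and C: "0 \<le> C"
  shows "\<exists>c\<in>K. norm (c - x) \<le> 2 * C * (DIM('a) + 1)"
proof -
  have fin: "\<exists>c\<in>K. norm (c - x) \<le> 2 * C * card S"
    if "finite S" "S \<subseteq> K" "x \<in> convex hull S" for S x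
    using that
  proof (induction S arbitrary: x rule: finite_induct)
    case empty
    then show ?case by simp
  next
    case (insert a S)
    show ?case
    proof (cases "S = {}")
      case True
      then show ?thesis using insert C by (intro bexI[of _ a]) auto
    next
      case False
      obtain u v b where uv: "0 \<le> u" "0 \<le> v" "u + v = 1" "b \<in> convex hull S" "x = u *\<^sub>R a + v *\<^sub>R b"
        using insert.prems(2) convex_hull_insert[OF False, of a] by auto
      obtain y where y: "y \<in> K" "norm (y - b) \<le> 2 * C * card S"
        using insert.IH[OF _ uv(4)] insert.prems(1) by auto
      have u: "u = 1 - v" using uv(3) by simp
      obtain c where c: "c \<in> K" "norm (c - (u *\<^sub>R a + v *\<^sub>R y)) \<le> 2 * C"
        using segment_near_if_midpoints_near[OF K mid _ y(1), of a v] insert.prems(1) uv u by auto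
      have "c - x = (c - (u *\<^sub>R a + v *\<^sub>R y)) + v *\<^sub>R (y - b)"
        unfolding uv(5) by (simp add: algebra_simps)
      then have "norm (c - x) \<le> 2 * C + norm (v *\<^sub>R (y - b))"
        using c(2) norm_triangle_ineq[of "c - (u *\<^sub>R a + v *\<^sub>R y)" "v *\<^sub>R (y - b)"]
        by (simp only:)
      also have "norm (v *\<^sub>R (y - b)) \<le> 1 * norm (y - b)"
        unfolding norm_scaleR using uv by (intro mult_right_mono) auto
      finally show ?thesis using c(1) y(2) insert.hyps
        by (intro bexI[of _ c]) (auto simp: algebra_simps)
    qed
  qed
  obtain S where S: "finite S" "S \<subseteq> K" "card S \<le> DIM('a) + 1" "x \<in> convex hull S"
    using x unfolding caratheodory[of K] by auto
  then obtain c where "c \<in> K" "norm (c - x) \<le> 2 * C * card S" using fin by blast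
  moreover have "2 * C * card S \<le> 2 * C * (DIM('a) + 1)"
    using S(3) C by (intro mult_left_mono) auto
  ultimately show ?thesis by force
qed

section \<open>The rotation set as an intersection of convex sets\<close>

text \<open>Telescoping over blocks of length \<open>N\<close>: the total displacement is
  \<open>m\<close> times an average of displacements of \<open>F ^^ N\<close>.\<close>

lemma funpow_displacement_in_hull:
  "(F ^^ (m * N)) z - z \<in> (\<lambda>v. real m *\<^sub>R v) ` (convex hull displacements (F ^^ N))"
proof (induction m)
  case 0
  have "(F ^^ N) z - z \<in> convex hull displacements (F ^^ N)"
    by (rule hull_inc) (simp add: displacements_def)
  then show ?case by force
next
  case (Suc m)
  define H where "H = convex hull displacements (F ^^ N)"
  obtain v where v: "v \<in> H" "(F ^^ (m * N)) z - z = real m *\<^sub>R v"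
    using Suc.IH by (auto simp: H_def)
  define y where "y = (F ^^ (m * N)) z"
  define w where "w = (F ^^ N) y - y"
  have w: "w \<in> H" unfolding H_def w_def by (rule hull_inc) (simp add: displacements_def)
  have u: "(real m / real (Suc m)) *\<^sub>R v + (1 / real (Suc m)) *\<^sub>R w \<in> H"
    by (rule convexD[OF _ v(1) w]) (auto simp: H_def add_divide_distrib[symmetric])
  have "(F ^^ (Suc m * N)) z - z = w + ((F ^^ (m * N)) z - z)"
    unfolding w_def y_def by (simp add: funpow_add)
  also have "\<dots> = real (Suc m) *\<^sub>R ((real m / real (Suc m)) *\<^sub>R v + (1 / real (Suc m)) *\<^sub>R w)"
    unfolding v(2) scaleR_right_distrib scaleR_scaleR by (simp add: add.commute)
  finally show ?case using u unfolding H_def by blast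
qed

lemma bounded_displacements_obtain:
  assumes "torus_lift F"
  obtains B where "0 \<le> B" "\<And>z. norm (F z - z) \<le> B"
proof -
  obtain B where "\<And>v. v \<in> displacements F \<Longrightarrow> norm v \<le> B"
    using compact_imp_bounded[OF compact_displacements[OF assms]] unfolding bounded_iff by blast
  then have B: "\<And>z. norm (F z - z) \<le> B" by (simp add: displacements_def)
  moreover have "0 \<le> B" using B[of 0] norm_ge_zero order_trans by blast
  ultimately show ?thesis using that by blast
qed

lemma funpow_displacement_le:
  fixes F :: "'a::real_normed_vector \<Rightarrow> 'a"
  assumes B: "\<And>z. norm (F z - z) \<le> B"
  shows "norm ((F ^^ n) z - z) \<le> real n * B"
proof (induction n)
  case (Suc n)
  have "(F ^^ Suc n) z - z = (F ((F ^^ n) z) - (F ^^ n) z) + ((F ^^ n) z - z)" by simp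
  then have "norm ((F ^^ Suc n) z - z) \<le> norm (F ((F ^^ n) z) - (F ^^ n) z) + norm ((F ^^ n) z - z)"
    by (metis norm_triangle_ineq)
  also have "\<dots> \<le> B + real n * B" using B Suc.IH by (intro add_mono) auto
  finally show ?case by (simp add: algebra_simps)
qed simp

text \<open>Cut an orbit of length \<open>n k\<close> into \<open>m k\<close> blocks of length
  \<open>N\<close> and a remainder of fewer than \<open>N\<close> steps. The block average
  \<open>h k\<close> lies in the compact hull, and the remainder has bounded displacement, so it
  disappears after division by \<open>n k\<close>.\<close>

lemma rot_set_subset_hull:
  assumes F: "torus_lift F" and v: "v \<in> rot_set F" and N: "0 < N"
  shows "real N *\<^sub>R v \<in> convex hull displacements (F ^^ N)"
proof -
  define H where "H = convex hull displacements (F ^^ N)"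
  have H: "compact H"
    unfolding H_def by (intro compact_convex_hull compact_displacements torus_lift_funpow F)
  obtain B where B: "0 \<le> B" "\<And>z. norm (F z - z) \<le> B" using bounded_displacements_obtain[OF F] by blast
  obtain D where D: "\<And>h. h \<in> H \<Longrightarrow> norm h \<le> D"
    using compact_imp_bounded[OF H] unfolding bounded_iff by blast
  obtain z n where n: "filterlim n at_top sequentially"
    and lim: "(\<lambda>k. (1 / real (n k)) *\<^sub>R ((F ^^ n k) (z k) - z k)) \<longlonglongrightarrow> v"
    using v unfolding rot_set_def by blast
  define m r where "m = (\<lambda>k. n k div N)" and "r = (\<lambda>k. n k mod N)"
  have nmr: "n k = r k + m k * N" "r k < N" for k using N by (auto simp: m_def r_def)
  have "\<exists>h\<in>H. (F ^^ (m k * N)) (z k) - z k = real (m k) *\<^sub>R h" for k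
    using funpow_displacement_in_hull[where F=F and m="m k" and N=N and z="z k"] unfolding H_def by blast
  then obtain h where h: "\<And>k. h k \<in> H" "\<And>k. (F ^^ (m k * N)) (z k) - z k = real (m k) *\<^sub>R h k"
    by metis
  have bound: "norm (h k - real N *\<^sub>R ((1 / real (n k)) *\<^sub>R ((F ^^ n k) (z k) - z k)))
      \<le> (real N * (D + real N * B)) / real (n k)" if "0 < n k" for k
  proof -
    define y where "y = (F ^^ (m k * N)) (z k)"
    have "(F ^^ n k) (z k) - z k = ((F ^^ r k) y - y) + real (m k) *\<^sub>R h k"
      unfolding nmr(1)[of k] y_def funpow_add h(2)[symmetric] by simp
    then have "h k - real N *\<^sub>R ((1 / real (n k)) *\<^sub>R ((F ^^ n k) (z k) - z k))
      = (1 - real N * real (m k) / real (n k)) *\<^sub>R h k - (real N / real (n k)) *\<^sub>R ((F ^^ r k) y - y)"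
      by (simp add: scaleR_right_distrib scaleR_left_diff_distrib)
    moreover have "1 - real N * real (m k) / real (n k) = real (r k) / real (n k)"
    proof -
      have "real (n k) = real (r k) + real (m k) * real N" using nmr(1)[of k] by (metis of_nat_add of_nat_mult)
      then show ?thesis using that by (simp add: field_simps)
    qed
    ultimately have "norm (h k - real N *\<^sub>R ((1 / real (n k)) *\<^sub>R ((F ^^ n k) (z k) - z k)))
        \<le> norm ((real (r k) / real (n k)) *\<^sub>R h k) + norm ((real N / real (n k)) *\<^sub>R ((F ^^ r k) y - y))"
      by (metis norm_triangle_ineq4)
    also have "\<dots> = real (r k) * norm (h k) / real (n k) + real N * norm ((F ^^ r k) y - y) / real (n k)"
      by simp
    also have "\<dots> \<le> real N * D / real (n k) + real N * (real N * B) / real (n k)"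
    proof (intro add_mono divide_right_mono mult_mono mult_left_mono)
      have "norm ((F ^^ r k) y - y) \<le> real (r k) * B" by (rule funpow_displacement_le[OF B(2)])
      also have "\<dots> \<le> real N * B" using nmr(2)[of k] B(1) by (intro mult_right_mono) auto
      finally show "norm ((F ^^ r k) y - y) \<le> real N * B" .
    qed (use nmr(2)[of k] D[OF h(1)] in auto)
    finally show ?thesis by (simp add: algebra_simps add_divide_distrib)
  qed
  have pos: "eventually (\<lambda>k. 0 < n k) sequentially"
    by (rule eventually_compose_filterlim[OF eventually_gt_at_top n])
  have "(\<lambda>k. (real N * (D + real N * B)) / real (n k)) \<longlonglongrightarrow> 0"
    by (rule tendsto_divide_0[OF tendsto_const])
       (intro filterlim_at_top_imp_at_infinity filterlim_compose[OF filterlim_real_sequentially n])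
  then have "(\<lambda>k. h k - real N *\<^sub>R ((1 / real (n k)) *\<^sub>R ((F ^^ n k) (z k) - z k))) \<longlonglongrightarrow> 0"
    by (rule Lim_null_comparison[rotated]) (use pos bound in \<open>auto elim!: eventually_mono\<close>)
  from tendsto_add[OF this tendsto_scaleR[OF tendsto_const[of "real N"] lim]]
  have "h \<longlonglongrightarrow> real N *\<^sub>R v" by (simp only: diff_add_cancel add_0)
  then show ?thesis
    using closed_sequentially[OF compact_imp_closed[OF H]] h(1) unfolding H_def by blast
qed

text \<open>For the converse inclusion, a point of the hull is within a distance independent of
  \<open>N\<close> of a true displacement of \<open>F ^^ N\<close>, and dividing by \<open>N\<close>
  makes the error vanish. This description makes convexity and closedness immediate.\<close>

lemma rot_set_eq_Inter_hull:
  assumes F: "torus_lift F"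
  shows "rot_set F = (\<Inter>N\<in>{0<..}. (\<lambda>v. real N *\<^sub>R v) -` (convex hull displacements (F ^^ N)))"
proof (intro equalityI subsetI)
  fix v assume "v \<in> rot_set F"
  then show "v \<in> (\<Inter>N\<in>{0<..}. (\<lambda>v. real N *\<^sub>R v) -` (convex hull displacements (F ^^ N)))"
    using rot_set_subset_hull[OF F] by blast
next
  fix v assume v: "v \<in> (\<Inter>N\<in>{0<..}. (\<lambda>v. real N *\<^sub>R v) -` (convex hull displacements (F ^^ N)))"
  \<comment> \<open>The constant is 2 for midpoints, doubled for segments, times 3 points in the
    plane.\<close>
  have "\<exists>z. norm ((F ^^ Suc N) z - z - real (Suc N) *\<^sub>R v) \<le> 12" for N
  proof -
    have L: "torus_lift (F ^^ Suc N)" by (rule torus_lift_funpow[OF F])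
    have "real (Suc N) *\<^sub>R v \<in> convex hull displacements (F ^^ Suc N)" using v by blast
    with convex_hull_near_if_midpoints_near[OF compact_displacements[OF L] displacements_near_midpoint[OF L]]
    have "\<exists>c\<in>displacements (F ^^ Suc N). norm (c - real (Suc N) *\<^sub>R v) \<le> 2 * 2 * real (DIM(real \<times> real) + 1)"
      by (simp del: funpow.simps)
    then obtain c where "c \<in> displacements (F ^^ Suc N)" "norm (c - real (Suc N) *\<^sub>R v) \<le> 12"
      by (auto simp del: funpow.simps)
    then show ?thesis unfolding displacements_def by blast
  qed
  then obtain z where z: "\<And>N. norm ((F ^^ Suc N) (z N) - z N - real (Suc N) *\<^sub>R v) \<le> 12" by metis
  have "norm ((1 / real (Suc N)) *\<^sub>R ((F ^^ Suc N) (z N) - z N) - v) \<le> 12 / real (Suc N)" for N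
  proof -
    have "(1 / real (Suc N)) *\<^sub>R ((F ^^ Suc N) (z N) - z N) - v
        = (1 / real (Suc N)) *\<^sub>R ((F ^^ Suc N) (z N) - z N - real (Suc N) *\<^sub>R v)"
      by (simp add: scaleR_right_diff_distrib)
    then show ?thesis using z[of N] by (simp add: divide_right_mono)
  qed
  moreover have "(\<lambda>N. 12 / real (Suc N)) \<longlonglongrightarrow> 0"
    by (rule LIMSEQ_Suc[OF lim_const_over_n])
  ultimately have "(\<lambda>N. (1 / real (Suc N)) *\<^sub>R ((F ^^ Suc N) (z N) - z N) - v) \<longlonglongrightarrow> 0"
    by (rule Lim_null_comparison[OF always_eventually[OF allI]])
  then have "(\<lambda>N. (1 / real (Suc N)) *\<^sub>R ((F ^^ Suc N) (z N) - z N)) \<longlonglongrightarrow> v"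
    by (rule Lim_null[THEN iffD2])
  then show "v \<in> rot_set F"
    unfolding rot_set_def using filterlim_Suc by blast
qed

lemma convex_rot_set:
  assumes "torus_lift F"
  shows "convex (rot_set F)"
  unfolding rot_set_eq_Inter_hull[OF assms]
  by (intro convex_INT convex_linear_vimage convex_convex_hull) (auto intro: linearI simp: scaleR_right_distrib)

lemma closed_rot_set:
  assumes "torus_lift F"
  shows "closed (rot_set F)"
  unfolding rot_set_eq_Inter_hull[OF assms]
proof (intro closed_INT ballI closed_vimage)
  fix N :: nat
  show "closed (convex hull displacements (F ^^ N))"
    by (intro compact_imp_closed compact_convex_hull compact_displacements torus_lift_funpow assms)
  show "continuous_on UNIV (\<lambda>v::real \<times> real. real N *\<^sub>R v)" by (intro continuous_intros)
qed

lemma rot_set_nonempty: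
  assumes "torus_lift F"
  shows "rot_set F \<noteq> {}"
proof -
  obtain B where B: "0 \<le> B" "\<And>z. norm (F z - z) \<le> B"
    using bounded_displacements_obtain[OF assms] by blast
  define u where "u = (\<lambda>n. (1 / real (Suc n)) *\<^sub>R ((F ^^ Suc n) 0 - 0))"
  have "u n \<in> cball 0 B" for n
    using funpow_displacement_le[OF B(2), of "Suc n" 0] by (simp add: u_def field_simps)
  then obtain v r where v: "strict_mono r" "(u \<circ> r) \<longlonglongrightarrow> v"
    using compact_cball[of 0 B] unfolding compact_def by metis
  have "filterlim (\<lambda>k. Suc (r k)) at_top sequentially"
    using filterlim_compose[OF filterlim_Suc filterlim_subseq[OF v(1)]] .
  then have "v \<in> rot_set F"
    using v(2) unfolding rot_set_def u_def o_def
    by (intro CollectI exI[of _ "\<lambda>_. 0"] exI[of _ "\<lambda>k. Suc (r k)"]) simp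
  then show ?thesis by blast
qed

section \<open>Oscillation of the displacement\<close>

lemma osc_upper:
  assumes "torus_lift F"
  shows "norm ((F x - x) - (F y - y)) \<le> osc F"
proof -
  obtain B where B: "0 \<le> B" "\<And>z. norm (F z - z) \<le> B"
    using bounded_displacements_obtain[OF assms] by blast
  have "bdd_above (range (\<lambda>p. norm ((F (fst p) - fst p) - (F (snd p) - snd p))))"
  proof (rule bdd_aboveI2)
    fix p
    show "norm ((F (fst p) - fst p) - (F (snd p) - snd p)) \<le> B + B"
      using norm_triangle_ineq4 B(2)[of "fst p"] B(2)[of "snd p"] by (smt (verit))
  qed
  from cSUP_upper[OF _ this, of "(x, y)"] show ?thesis by (simp add: osc_def)
qed

text \<open>The hull description with \<open>N = 1\<close>: the rotation set lies in the hull of the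
  displacements of \<open>F\<close>, hence in every ball of radius \<open>osc F\<close> about one of
  them.\<close>

lemma displacement_near_rot_set:
  assumes "torus_lift F" "v \<in> rot_set F"
  shows "norm (F x - x - v) \<le> osc F"
proof -
  have "v \<in> convex hull displacements F"
    using rot_set_subset_hull[OF assms, of 1] by (simp add: displacements_def)
  moreover have "convex hull displacements F \<subseteq> cball (F x - x) (osc F)"
    using osc_upper[OF assms(1), of x] by (intro hull_minimal) (auto simp: displacements_def dist_norm)
  ultimately show ?thesis by (auto simp: dist_norm)
qed

section \<open>Shears of the torus\<close>

text \<open>Used for orthogonal \<open>n\<close> and \<open>u\<close>: then
  \<open>n \<bullet> z\<close> is unchanged, each line in direction \<open>u\<close> is translated
  along itself, and negating \<open>\<phi>\<close> gives the inverse. Neither vector is normalised,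
  so that both can be integral.\<close>

definition shear :: "(real \<Rightarrow> real) \<Rightarrow> real \<times> real \<Rightarrow> real \<times> real \<Rightarrow> real \<times> real \<Rightarrow> real \<times> real" where
  "shear \<phi> n u z = z + \<phi> (n \<bullet> z) *\<^sub>R u"

lemma continuous_shear:
  assumes "continuous_on UNIV \<phi>"
  shows "continuous_on S (shear \<phi> n u)"
  unfolding shear_def by (intro continuous_intros continuous_on_compose2[OF assms]) auto

lemma shear_shear_minus:
  assumes "n \<bullet> u = 0"
  shows "shear \<phi> n u (shear (\<lambda>t. - \<phi> t) n u z) = z"
  using assms by (simp add: shear_def inner_add_right inner_diff_right)

lemma shear_minus_shear:
  assumes "n \<bullet> u = 0"
  shows "shear (\<lambda>t. - \<phi> t) n u (shear \<phi> n u z) = z"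
  using assms by (simp add: shear_def inner_add_right inner_diff_right)

text \<open>Serves to cut the plane into strips for the area of a shear, and later to approximate a
  direction by lattice vectors.\<close>

lemma floor_mult_div_tendsto:
  "(\<lambda>m. of_int \<lfloor>real (Suc m) * t\<rfloor> / real (Suc m)) \<longlonglongrightarrow> t"
proof -
  have "norm (of_int \<lfloor>real (Suc m) * t\<rfloor> / real (Suc m) - t) \<le> 1 / real (Suc m)" for m
  proof -
    define j where "j = \<lfloor>real (Suc m) * t\<rfloor>"
    have "of_int j \<le> real (Suc m) * t" "real (Suc m) * t < of_int j + 1"
      unfolding j_def by linarith+
    then have "of_int j / real (Suc m) \<le> t" "t \<le> of_int j / real (Suc m) + 1 / real (Suc m)"
      by (auto simp: field_simps)
    then show ?thesis by (simp add: j_def)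
  qed
  moreover have "(\<lambda>m. 1 / real (Suc m)) \<longlonglongrightarrow> 0"
    by (rule LIMSEQ_Suc[OF lim_const_over_n])
  ultimately have "(\<lambda>m. of_int \<lfloor>real (Suc m) * t\<rfloor> / real (Suc m) - t) \<longlonglongrightarrow> 0"
    by (rule Lim_null_comparison[OF always_eventually[OF allI]])
  then show ?thesis by (rule Lim_null[THEN iffD2])
qed

text \<open>A shear is a pointwise limit of maps that translate each strip of a partition along
  itself; Fatou's lemma turns this into an inequality for open sets.\<close>

lemma emeasure_shear_vimage_le:
  assumes c: "continuous_on UNIV \<phi>" and nu: "n \<bullet> u = 0" and U: "open U"
  shows "emeasure lborel (shear \<phi> n u -` U) \<le> emeasure lborel U"
proof -
  define q where "q = (\<lambda>m t. \<lfloor>real (Suc m) * t\<rfloor>)"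
  define T where "T = (\<lambda>m z. z + \<phi> (of_int (q m (n \<bullet> z)) / real (Suc m)) *\<^sub>R u)"
  define S where "S = (\<lambda>m (j::int). {z. q m (n \<bullet> z) = j})"
  have S: "S m j \<in> sets borel" for m j
  proof -
    have "(\<lambda>z. q m (n \<bullet> z)) \<in> measurable borel (count_space UNIV)"
      unfolding q_def by measurable
    then show ?thesis unfolding S_def by measurable
  qed
  have "T m \<in> borel_measurable borel" for m
    unfolding T_def q_def
    using borel_measurable_continuous_onI[OF c] by measurable
  note T = this
  have UB: "U \<in> sets borel" using U by simp
  have TU: "T m -` U \<in> sets borel" for m
    using measurable_sets[OF T[of m] UB] by simp
  have em: "emeasure lborel (T m -` U) = emeasure lborel U" for m
  proof -
    have piece: "emeasure lborel (T m -` U \<inter> S m j) = emeasure lborel (U \<inter> S m j)" for j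
    proof -
      define v where "v = \<phi> (of_int j / real (Suc m)) *\<^sub>R u"
      have "T m -` U \<inter> S m j = (+) v -` (U \<inter> S m j)"
        unfolding T_def S_def v_def using nu by (auto simp: inner_add_right add.commute)
      also have "emeasure lborel \<dots> = emeasure (distr lborel borel ((+) v)) (U \<inter> S m j)"
        using UB S by (subst emeasure_distr) auto
      finally show ?thesis by (simp add: lborel_distr_plus)
    qed
    have sum: "emeasure lborel A = (\<integral>\<^sup>+ j. emeasure lborel (A \<inter> S m j) \<partial>count_space UNIV)"
      if "A \<in> sets borel" for A
    proof -
      have "emeasure lborel (\<Union>j\<in>UNIV. A \<inter> S m j) = (\<integral>\<^sup>+ j. emeasure lborel (A \<inter> S m j) \<partial>count_space UNIV)"
        by (rule emeasure_UN_countable) (use that S in \<open>auto simp: disjoint_family_on_def S_def\<close>)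
      moreover have "(\<Union>j\<in>UNIV. A \<inter> S m j) = A" by (auto simp: S_def)
      ultimately show ?thesis by simp
    qed
    show ?thesis by (simp only: sum[OF TU] sum[OF UB] piece)
  qed
  have conv: "(\<lambda>m. T m z) \<longlonglongrightarrow> shear \<phi> n u z" for z
  proof -
    define t where "t = n \<bullet> z"
    have "(\<lambda>m. of_int (q m t) / real (Suc m)) \<longlonglongrightarrow> t"
      unfolding q_def by (rule floor_mult_div_tendsto)
    then have "(\<lambda>m. \<phi> (of_int (q m t) / real (Suc m))) \<longlonglongrightarrow> \<phi> t"
      by (rule continuous_on_tendsto_compose[OF c]) auto
    then show ?thesis unfolding T_def shear_def t_def by (intro tendsto_intros)
  qed
  have SU: "shear \<phi> n u -` U \<in> sets borel"
    using open_vimage[OF U continuous_shear[OF c]] by simp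
  have "emeasure lborel (shear \<phi> n u -` U) = (\<integral>\<^sup>+ z. indicator (shear \<phi> n u -` U) z \<partial>lborel)"
    using SU by simp
  \<comment> \<open>Openness of \<open>U\<close> enters here: if the limit lies in \<open>U\<close>,
    so do all but finitely many approximants.\<close>
  also have "\<dots> \<le> (\<integral>\<^sup>+ z. liminf (\<lambda>m. indicator (T m -` U) z) \<partial>lborel)"
  proof (rule nn_integral_mono)
    fix z
    show "indicator (shear \<phi> n u -` U) z \<le> liminf (\<lambda>m. indicator (T m -` U) z :: ennreal)"
    proof (cases "shear \<phi> n u z \<in> U")
      case True
      then have "eventually (\<lambda>m. T m z \<in> U) sequentially"
        using topological_tendstoD[OF conv U] by blast
      then have "eventually (\<lambda>m. 1 \<le> (indicator (T m -` U) z :: ennreal)) sequentially"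
        by (rule eventually_mono) simp
      then show ?thesis using True by (simp add: Liminf_bounded)
    qed simp
  qed
  also have "\<dots> \<le> liminf (\<lambda>m. \<integral>\<^sup>+ z. indicator (T m -` U) z \<partial>lborel)"
    by (rule nn_integral_liminf) (use TU in simp)
  also have "\<dots> = emeasure lborel U" using TU by (simp add: em Liminf_const)
  finally show ?thesis .
qed

lemma area_preserving_shear:
  assumes c: "continuous_on UNIV \<phi>" and nu: "n \<bullet> u = 0"
  shows "area_preserving (shear \<phi> n u)"
proof -
  have op: "emeasure lborel (shear \<phi> n u -` U) = emeasure lborel U" if U: "open U" for U
  proof (rule antisym)
    show "emeasure lborel (shear \<phi> n u -` U) \<le> emeasure lborel U"
      by (rule emeasure_shear_vimage_le[OF c nu U])
    have "continuous_on UNIV (\<lambda>t. - \<phi> t)" using c by (intro continuous_intros)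
    moreover have "open (shear \<phi> n u -` U)" by (rule open_vimage[OF U continuous_shear[OF c]])
    ultimately have "emeasure lborel (shear (\<lambda>t. - \<phi> t) n u -` (shear \<phi> n u -` U))
        \<le> emeasure lborel (shear \<phi> n u -` U)"
      by (rule emeasure_shear_vimage_le[OF _ nu])
    then show "emeasure lborel U \<le> emeasure lborel (shear \<phi> n u -` U)"
      by (simp add: vimage_def shear_shear_minus[OF nu])
  qed
  have m: "shear \<phi> n u \<in> borel_measurable borel"
    by (rule borel_measurable_continuous_onI[OF continuous_shear[OF c]])
  have "lborel = distr lborel borel (shear \<phi> n u)"
    by (rule lborel_eqI) (use m in \<open>simp_all add: emeasure_distr op open_box emeasure_lborel_box\<close>)
  then have "emeasure lborel A = emeasure (distr lborel borel (shear \<phi> n u)) A" for A by simp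
  then show ?thesis
    unfolding area_preserving_def using m by (auto simp: emeasure_distr)
qed

text \<open>Since \<open>n\<close> is integral, an integer translation changes
  \<open>n \<bullet> z\<close> by an integer, which the period of \<open>\<phi>\<close>
  absorbs.\<close>

lemma torus_lift_shear:
  assumes c: "continuous_on UNIV \<phi>" and per: "\<And>t j. j \<in> \<int> \<Longrightarrow> \<phi> (t + j) = \<phi> t"
    and nu: "n \<bullet> u = 0" and n: "n \<in> Zsq"
  shows "torus_lift (shear \<phi> n u)"
proof -
  have "continuous_on UNIV (\<lambda>t. - \<phi> t)" using c by (intro continuous_intros)
  then have "homeomorphism UNIV UNIV (shear \<phi> n u) (shear (\<lambda>t. - \<phi> t) n u)"
    by (intro homeomorphismI continuous_shear c)
       (auto simp: shear_shear_minus[OF nu] shear_minus_shear[OF nu])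
  moreover have "shear \<phi> n u (z + k) = shear \<phi> n u z + k" if "k \<in> Zsq" for z k
  proof -
    have "n \<bullet> k \<in> \<int>" using n that by (auto simp: Zsq_def inner_prod_def)
    then show ?thesis by (simp add: shear_def inner_add_right per)
  qed
  ultimately show ?thesis unfolding torus_lift_def by blast
qed

lemma inH_comp:
  assumes "inH area F" "inH area G"
  shows "inH area (F \<circ> G)"
proof -
  have "area_preserving (F \<circ> G)" if "area_preserving F" "area_preserving G" "continuous_on UNIV F"
    using that measurable_sets[OF borel_measurable_continuous_onI[OF that(3)]]
    unfolding area_preserving_def by (auto simp: vimage_comp[symmetric])
  then show ?thesis using assms torus_lift_comp torus_lift_continuous unfolding inH_def by blast
qed

lemma inH_shear:
  assumes "continuous_on UNIV \<phi>" "\<And>t j. j \<in> \<int> \<Longrightarrow> \<phi> (t + j) = \<phi> t" "n \<bullet> u = 0" "n \<in> Zsq"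
  shows "inH area (shear \<phi> n u)"
  using area_preserving_shear torus_lift_shear assms unfolding inH_def by blast

section \<open>Periodic functions with prescribed values\<close>

text \<open>Nodes distinct modulo 1 are distinct points of the unit circle, where Tietze extends a
  function on a finite set with the same bound. The zero at \<open>s\<close> will give the
  perturbation a fixed point.\<close>

lemma periodic_interpolation:
  fixes t c :: "nat \<Rightarrow> real"
  assumes gen: "\<And>i j. i < q \<Longrightarrow> j < q \<Longrightarrow> i \<noteq> j \<Longrightarrow> t i - t j \<notin> \<int>"
    and c: "\<And>i. i < q \<Longrightarrow> \<bar>c i\<bar> \<le> M" and M: "0 \<le> M"
  obtains \<phi> s where "continuous_on UNIV \<phi>" "\<And>x j. j \<in> \<int> \<Longrightarrow> \<phi> (x + j) = \<phi> x"
    "\<And>i. i < q \<Longrightarrow> \<phi> (t i) = c i" "\<And>x. \<bar>\<phi> x\<bar> \<le> M" "\<phi> s = (0::real)"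
proof -
  have "\<not> {0<..<1::real} \<subseteq> (\<lambda>i. frac (t i)) ` {..<q}"
    using finite_subset[of "{0<..<1::real}" "(\<lambda>i. frac (t i)) ` {..<q}"] infinite_Ioo[of 0 "1::real"]
    by auto
  then obtain s where s: "s \<in> {0<..<1}" "\<And>i. i < q \<Longrightarrow> frac (t i) \<noteq> s" by blast
  have fs: "frac s = s" using s(1) by (simp add: frac_eq)
  \<comment> \<open>The additional node \<open>s\<close>, with value 0, is appended under the index
    \<open>q\<close>.\<close>
  define t' where "t' = (\<lambda>i. if i < q then t i else s)"
  define c' where "c' = (\<lambda>i. if i < q then c i else 0)"
  have frac_int: "frac x = frac y" if xy: "x - y \<in> \<int>" for x y :: real
  proof -
    obtain m where "x - y = of_int m" using xy by (rule Ints_cases)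
    then have "x = y + of_int m" by simp
    then show ?thesis by (simp add: frac_def)
  qed
  have gen': "t' i - t' j \<notin> \<int>" if "i \<le> q" "j \<le> q" "i \<noteq> j" for i j
    using gen[of i j] frac_int[of "t i" s] frac_int[of s "t j"] s(2)[of i] s(2)[of j] fs that
    by (auto simp: t'_def)
  define e where "e = (\<lambda>x::real. cis (2 * pi * x))"
  have e_eq: "e x = e y \<longleftrightarrow> x - y \<in> \<int>" for x y
  proof
    assume "e x = e y"
    then have "sin (2 * pi * x) = sin (2 * pi * y) \<and> cos (2 * pi * x) = cos (2 * pi * y)"
      by (simp add: e_def cis.ctr)
    then obtain m :: int where "2 * pi * x = 2 * pi * y + 2 * pi * m"
      using sin_cos_eq_iff by blast
    then have "2 * pi * (x - y - m) = 0" by (simp add: algebra_simps)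
    then have "x - y = of_int m" by simp
    then show "x - y \<in> \<int>" by simp
  next
    assume "x - y \<in> \<int>"
    then obtain m :: int where m: "x - y = of_int m" by (rule Ints_cases)
    then have "x = y + of_int m" by simp
    then have "e x = cis (2 * pi * y) * cis (2 * pi * m)"
      by (simp add: e_def cis_mult algebra_simps)
    also have "cis (2 * pi * m) = 1" by (rule cis_multiple_2pi) simp
    finally show "e x = e y" by (simp add: e_def)
  qed
  have inj: "inj_on (e \<circ> t') {..q}"
    using gen' by (auto simp: inj_on_def e_eq)
  define A where "A = (e \<circ> t') ` {..q}"
  define f where "f = (\<lambda>z. c' (the_inv_into {..q} (e \<circ> t') z))"
  have f: "f (e (t' i)) = c' i" if "i \<le> q" for i
    using the_inv_into_f_f[OF inj, of i] that by (simp add: f_def)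
  have "finite A" by (simp add: A_def)
  have "continuous_on A f" using \<open>finite A\<close> by (rule continuous_on_finite)
  moreover have "closedin (top_of_set UNIV) A" using \<open>finite A\<close> by (simp add: finite_imp_closed)
  moreover have "norm (f z) \<le> M" if "z \<in> A" for z
    using that f c M by (auto simp: A_def c'_def)
  ultimately obtain g where g: "continuous_on UNIV g" "\<And>z. z \<in> A \<Longrightarrow> g z = f z" "\<And>z. norm (g z) \<le> M"
    using Tietze[of A f UNIV M] M by (metis UNIV_I)
  have ge: "g (e (t' i)) = c' i" if "i \<le> q" for i
    using g(2)[of "e (t' i)"] f[OF that] that by (simp add: A_def)
  show ?thesis
  proof (rule that[of "g \<circ> e" s])
    show "continuous_on UNIV (g \<circ> e)" unfolding e_def cis_conv_exp o_def
      by (intro continuous_on_compose2[OF g(1)] continuous_intros) auto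
    show "(g \<circ> e) (x + j) = (g \<circ> e) x" if "j \<in> \<int>" for x j
      using e_eq[of "x + j" x] that by simp
    show "(g \<circ> e) (t i) = c i" if "i < q" for i
      using ge[of i] that by (simp add: t'_def c'_def)
    show "\<bar>(g \<circ> e) x\<bar> \<le> M" for x using g(3)[of "e x"] by simp
    show "(g \<circ> e) s = 0"
      using ge[of q] by (simp add: t'_def c'_def)
  qed
qed

section \<open>Realising periodic pseudo-orbits\<close>

lemma interior_affine_integers_empty:
  fixes w :: "real \<times> real"
  assumes "w \<noteq> 0"
  shows "interior {p. w \<bullet> p - c \<in> \<int>} = {}"
proof (rule ccontr)
  assume "interior {p. w \<bullet> p - c \<in> \<int>} \<noteq> {}"
  then obtain p e where e: "0 < e" "ball p e \<subseteq> {p. w \<bullet> p - c \<in> \<int>}"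
    by (meson ex_in_conv mem_interior)
  \<comment> \<open>The first bound keeps \<open>p + s *\<^sub>R w\<close> in the ball; the second
    makes the product with \<open>w\<close> change by a positive amount of at most 1/2, which is no
    integer.\<close>
  define s where "s = min (e / (2 * norm w)) (1 / (2 * (w \<bullet> w)))"
  have w: "0 < norm w" "0 < w \<bullet> w" using assms by auto
  have s: "0 < s" "s \<le> e / (2 * norm w)" "s \<le> 1 / (2 * (w \<bullet> w))"
    using e(1) w by (auto simp: s_def)
  have "s * norm w \<le> e / 2" "s * (w \<bullet> w) \<le> 1 / 2"
    using s(2,3) w by (auto simp: field_simps)
  then have "p + s *\<^sub>R w \<in> ball p e" using e(1) s(1) by (simp add: dist_norm)
  moreover have "p \<in> ball p e" using e(1) by simp
  ultimately have "w \<bullet> (p + s *\<^sub>R w) - c \<in> \<int>" "w \<bullet> p - c \<in> \<int>" using e(2) by blast+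
  then have "(w \<bullet> (p + s *\<^sub>R w) - c) - (w \<bullet> p - c) \<in> \<int>" by (rule Ints_diff)
  then have "s * (w \<bullet> w) \<in> \<int>" by (simp add: inner_add_right)
  moreover have "0 < s * (w \<bullet> w)" using s(1) w(2) by simp
  ultimately show False
    using Ints_nonzero_abs_ge1[of "s * (w \<bullet> w)"] \<open>s * (w \<bullet> w) \<le> 1 / 2\<close> s(1) assms
    by auto
qed

lemma interior_vimage_homeomorphism_empty:
  assumes "homeomorphism UNIV UNIV F G" "interior Z = {}"
  shows "interior (F -` Z) = {}"
proof -
  have G: "continuous_on UNIV G" and FG: "\<And>y. F (G y) = y"
    using assms(1) by (auto simp: homeomorphism_def)
  have "open (G -` interior (F -` Z))" by (rule open_vimage[OF open_interior G])
  moreover have "G -` interior (F -` Z) \<subseteq> Z"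
  proof
    fix y assume "y \<in> G -` interior (F -` Z)"
    then have "F (G y) \<in> Z" using interior_subset by blast
    then show "y \<in> Z" by (simp add: FG)
  qed
  ultimately have "G -` interior (F -` Z) = {}" using assms(2) interior_maximal by blast
  moreover have "surj G" using assms(1) by (auto simp: homeomorphism_def)
  ultimately show ?thesis by (metis surj_image_vimage_eq image_empty)
qed

lemma interior_finite_UN_closed_empty:
  assumes "finite I" "\<And>i. i \<in> I \<Longrightarrow> closed (A i)" "\<And>i. i \<in> I \<Longrightarrow> interior (A i) = {}"
  shows "interior (\<Union>i\<in>I. A i) = {}"
  using assms
proof (induction I rule: finite_induct)
  case (insert i I)
  then have "interior (\<Union>i\<in>I. A i) = {}" by simp
  then have "interior (A i \<union> (\<Union>i\<in>I. A i)) = interior (A i)"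
    using insert.prems by (intro interior_closed_Un_empty_interior) auto
  then show ?case using insert.prems by simp
qed simp

text \<open>The points are chosen one after another. Each earlier point excludes two closed sets
  with empty interior, and finitely many of these cannot fill a ball. The condition along
  \<open>w'\<close> separates the interpolation nodes of the first shear, the one along
  \<open>w\<close> those of the second.\<close>

lemma generic_perturbation:
  fixes y :: "nat \<Rightarrow> real \<times> real"
  assumes F: "torus_lift F" and w: "w \<noteq> 0" "w' \<noteq> 0" and d: "0 < d"
  obtains y' where "\<And>l. l < q \<Longrightarrow> norm (y' l - y l) < d"
    "\<And>i j. i < q \<Longrightarrow> j < q \<Longrightarrow> i \<noteq> j \<Longrightarrow> w \<bullet> y' i - w \<bullet> y' j \<notin> \<int>"
    "\<And>i j. i < q \<Longrightarrow> j < q \<Longrightarrow> i \<noteq> j \<Longrightarrow> w' \<bullet> F (y' i) - w' \<bullet> F (y' j) \<notin> \<int>"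
proof -
  obtain G where G: "homeomorphism UNIV UNIV F G" using F by (auto simp: torus_lift_def)
  have contF: "continuous_on UNIV F" by (rule torus_lift_continuous[OF F])
  have Ints_flip: "a - b \<in> \<int> \<longleftrightarrow> b - a \<in> \<int>" for a b :: real
    using Ints_minus[of "a - b"] Ints_minus[of "b - a"] by auto
  have "\<exists>y'. (\<forall>l<q. norm (y' l - y l) < d) \<and>
    (\<forall>i<q. \<forall>j<q. i \<noteq> j \<longrightarrow> w \<bullet> y' i - w \<bullet> y' j \<notin> \<int> \<and> w' \<bullet> F (y' i) - w' \<bullet> F (y' j) \<notin> \<int>)"
  proof (induction q)
    case (Suc q)
    then obtain y' where y': "\<And>l. l < q \<Longrightarrow> norm (y' l - y l) < d"
      "\<And>i j. i < q \<Longrightarrow> j < q \<Longrightarrow> i \<noteq> j \<Longrightarrow> w \<bullet> y' i - w \<bullet> y' j \<notin> \<int> \<and> w' \<bullet> F (y' i) - w' \<bullet> F (y' j) \<notin> \<int>"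
      by blast
    define A where "A = (\<lambda>j. {p. w \<bullet> p - w \<bullet> y' j \<in> \<int>})"
    define A' where "A' = (\<lambda>j. F -` {p. w' \<bullet> p - w' \<bullet> F (y' j) \<in> \<int>})"
    have cl: "closed {p. v \<bullet> p - c \<in> \<int>}" for v :: "real \<times> real" and c
      using closed_vimage[OF closed_Ints, of "\<lambda>p. v \<bullet> p - c"]
      by (simp add: vimage_def continuous_intros)
    have "closed (A j)" "closed (A' j)" "interior (A j) = {}" "interior (A' j) = {}" for j
      unfolding A_def A'_def
      using cl closed_vimage[OF cl contF] interior_affine_integers_empty[OF w(1)]
        interior_vimage_homeomorphism_empty[OF G interior_affine_integers_empty[OF w(2)]]
      by blast+
    then have "interior (\<Union>j\<in>{..<q}. A j \<union> A' j) = {}"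
      by (intro interior_finite_UN_closed_empty) (auto simp: interior_closed_Un_empty_interior)
    then have "\<not> ball (y q) d \<subseteq> (\<Union>j\<in>{..<q}. A j \<union> A' j)"
      using d interior_maximal[of "ball (y q) d" "\<Union>j\<in>{..<q}. A j \<union> A' j"] by force
    then obtain p where p: "p \<in> ball (y q) d" "\<And>j. j < q \<Longrightarrow> p \<notin> A j \<and> p \<notin> A' j"
      by blast
    have pA: "w \<bullet> p - w \<bullet> y' j \<notin> \<int>" "w' \<bullet> F p - w' \<bullet> F (y' j) \<notin> \<int>"
      "w \<bullet> y' j - w \<bullet> p \<notin> \<int>" "w' \<bullet> F (y' j) - w' \<bullet> F p \<notin> \<int>" if "j < q" for j
      using p(2)[OF that] Ints_flip[of "w \<bullet> p"] Ints_flip[of "w' \<bullet> F p"] by (simp_all add: A_def A'_def)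
    have "norm (p - y q) < d" using p(1) by (simp add: dist_norm norm_minus_commute)
    then show ?case using y' pA
      by (intro exI[of _ "y'(q := p)"]) (auto simp: less_Suc_eq)
  qed simp
  then show ?thesis using that by blast
qed

text \<open>In a frame at 45 degrees both components of \<open>e\<close> have size
  \<open>norm e / sqrt 2\<close>. The strict inequality \<open>norm e < eps\<close> leaves room to
  replace the exact diagonal by a nearby lattice direction.\<close>

lemma diagonal_lattice_direction:
  fixes e :: "real \<times> real"
  assumes "norm e < eps"
  obtains w where "w \<in> Zsq" "w \<noteq> 0" "sqrt 2 * \<bar>e \<bullet> w\<bar> < eps * norm w"
    "sqrt 2 * \<bar>e \<bullet> (- snd w, fst w)\<bar> < eps * norm w"
proof -
  have eps: "0 < eps" using assms norm_ge_zero[of e] by linarith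
  \<comment> \<open>\<open>m\<close> is \<open>e\<close> turned by 45 degrees; lattice directions approximate it\<close>
  define m where "m = (if e = 0 then (1, 0) else (fst e - snd e, fst e + snd e))"
  have nm: "norm m = (if e = 0 then 1 else sqrt 2 * norm e)"
    by (auto simp: m_def norm_prod_def power2_eq_square algebra_simps simp flip: real_sqrt_mult)
  have em: "\<bar>e \<bullet> m\<bar> = (norm e)\<^sup>2" "\<bar>e \<bullet> (- snd m, fst m)\<bar> = (norm e)\<^sup>2"
    by (auto simp: m_def inner_prod_def norm_prod_def power2_eq_square algebra_simps abs_real_def)
  have lt: "sqrt 2 * (norm e)\<^sup>2 < eps * norm m"
  proof (cases "e = 0")
    case False
    then have "norm e * norm e < eps * norm e" using assms by (intro mult_strict_right_mono) auto
    then show ?thesis using False by (simp add: nm power2_eq_square mult.left_commute)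
  qed (use eps in \<open>simp add: nm\<close>)
  \<comment> \<open>Rational approximations of \<open>m\<close>; clearing the denominator gives the
    integer vector \<open>w\<close>, and both inequalities are homogeneous in
    \<open>w\<close>.\<close>
  define v where "v = (\<lambda>N. (of_int \<lfloor>real (Suc N) * fst m\<rfloor> / real (Suc N),
    of_int \<lfloor>real (Suc N) * snd m\<rfloor> / real (Suc N)))"
  have v: "v \<longlonglongrightarrow> m"
    using tendsto_Pair[OF floor_mult_div_tendsto[of "fst m"] floor_mult_div_tendsto[of "snd m"]]
    by (simp add: v_def)
  have "(\<lambda>N. eps * norm (v N) - sqrt 2 * \<bar>e \<bullet> v N\<bar>) \<longlonglongrightarrow> eps * norm m - sqrt 2 * \<bar>e \<bullet> m\<bar>"
    by (intro tendsto_intros v)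
  moreover have "(\<lambda>N. eps * norm (v N) - sqrt 2 * \<bar>e \<bullet> (- snd (v N), fst (v N))\<bar>)
      \<longlonglongrightarrow> eps * norm m - sqrt 2 * \<bar>e \<bullet> (- snd m, fst m)\<bar>"
    by (intro tendsto_intros v)
  moreover have "0 < eps * norm m - sqrt 2 * \<bar>e \<bullet> m\<bar>"
    "0 < eps * norm m - sqrt 2 * \<bar>e \<bullet> (- snd m, fst m)\<bar>"
    unfolding em using lt by simp_all
  ultimately have "eventually (\<lambda>N. 0 < eps * norm (v N) - sqrt 2 * \<bar>e \<bullet> v N\<bar>
      \<and> 0 < eps * norm (v N) - sqrt 2 * \<bar>e \<bullet> (- snd (v N), fst (v N))\<bar>) sequentially"
    by (intro eventually_conj order_tendstoD(1))
  then obtain N where N: "sqrt 2 * \<bar>e \<bullet> v N\<bar> < eps * norm (v N)"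
    "sqrt 2 * \<bar>e \<bullet> (- snd (v N), fst (v N))\<bar> < eps * norm (v N)"
    by (auto simp: eventually_sequentially)
  define w where "w = real (Suc N) *\<^sub>R v N"
  have w: "w = (of_int \<lfloor>real (Suc N) * fst m\<rfloor>, of_int \<lfloor>real (Suc N) * snd m\<rfloor>)"
    by (simp add: w_def v_def)
  have rot: "(- snd w, fst w) = real (Suc N) *\<^sub>R (- snd (v N), fst (v N))" by (simp add: w_def)
  have 1: "sqrt 2 * \<bar>e \<bullet> w\<bar> < eps * norm w"
    using mult_strict_left_mono[OF N(1), of "real (Suc N)"]
    by (simp add: w_def abs_mult mult.left_commute)
  have 2: "sqrt 2 * \<bar>e \<bullet> (- snd w, fst w)\<bar> < eps * norm w"
    unfolding rot inner_scaleR_right abs_mult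
    using mult_strict_left_mono[OF N(2), of "real (Suc N)"] by (simp add: w_def mult.left_commute)
  have "w \<noteq> 0" using 1 by auto
  then show ?thesis using that[of w] 1 2 w by (simp add: Zsq_def)
qed

lemma periodic_point_rotation_vector:
  assumes G: "torus_lift G" and k: "k \<in> Zsq" and q: "0 < q" and z: "(G ^^ q) z = z + k"
  shows "(1 / real q) *\<^sub>R k \<in> rot_set G"
proof -
  have it: "(G ^^ (q * m)) z = z + real m *\<^sub>R k \<and> real m *\<^sub>R k \<in> Zsq" for m
  proof (induction m)
    case (Suc m)
    have "(G ^^ (q * Suc m)) z = (G ^^ q) ((G ^^ (q * m)) z)"
      by (simp add: funpow_add)
    also have "\<dots> = (G ^^ q) z + real m *\<^sub>R k"
      using Suc torus_lift_add[OF torus_lift_funpow[OF G]] by simp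
    finally show ?case using z Suc Zsq_add[OF k, of "real m *\<^sub>R k"]
      by (simp add: scaleR_left_distrib add.assoc)
  qed simp
  have "(1 / real (q * Suc m)) *\<^sub>R ((G ^^ (q * Suc m)) z - z) = (1 / real q) *\<^sub>R k" for m
    unfolding it[THEN conjunct1] by (simp del: of_nat_Suc mult_Suc_right)
  moreover have "filterlim (\<lambda>m. q * Suc m) at_top sequentially"
    by (rule filterlim_compose[OF _ filterlim_Suc]) (use q in \<open>simp add: mult_nat_left_at_top\<close>)
  ultimately show ?thesis
    unfolding rot_set_def
    by (intro CollectI exI[of _ "\<lambda>_. z"] exI[of _ "\<lambda>m. q * Suc m"]) simp
qed

text \<open>Stability concerns a closest lift \<open>G + k\<close>, so \<open>k = 0\<close> has to
  be shown. At the coincidence point \<open>x0\<close> the translated lift is at distance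
  \<open>norm k\<close> from \<open>F\<close>, while the closest one is at distance at most
  \<open>M < 1\<close>.\<close>

lemma upper_stable_rot_set_subset:
  assumes st: "upper_stable area F eps" and eps: "eps < 1" and G: "inH area G"
    and close: "\<And>x. norm (F x - G x) \<le> M" and M: "M < eps" and fp: "F x0 = G x0"
  shows "rot_set G \<subseteq> rot_set F"
proof -
  have "torus_dist (F x) (G x) \<le> M" for x
    using infdist_le[OF Zsq_0, of "F x - G x"] close[of x] by (simp add: torus_dist_def)
  then have "dC0 F G \<le> M" unfolding dC0_def by (intro cSUP_least) auto
  then have "inH area G \<and> dC0 F G < eps" using G M by simp
  from st[unfolded upper_stable_def, rule_format, OF this]
  obtain k where k: "k \<in> Zsq" "rot_set (\<lambda>x. G x + k) \<subseteq> rot_set F"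
    "\<And>k'. k' \<in> Zsq \<Longrightarrow> (SUP x. norm (F x - (G x + k))) \<le> (SUP x. norm (F x - (G x + k')))"
    by blast
  have "norm (F x - (G x + k)) \<le> M + norm k" for x
    using norm_triangle_ineq4[of "F x - G x" k] close[of x] by (simp add: algebra_simps)
  then have "bdd_above (range (\<lambda>x. norm (F x - (G x + k))))" by (rule bdd_aboveI2)
  from cSUP_upper[OF _ this, of x0] have "norm k \<le> (SUP x. norm (F x - (G x + k)))"
    by (simp add: fp)
  also have "\<dots> \<le> (SUP x. norm (F x - (G x + 0)))" by (rule k(3)) simp
  also have "\<dots> \<le> M" using close by (intro cSUP_least) auto
  finally have "k = 0" using Zsq_norm_ge_1[OF k(1)] M eps by force
  then show ?thesis using k(2) by simp
qed

text \<open>\<open>h\<close> is a shear along \<open>w\<close> followed by one along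
  \<open>w'\<close>, interpolating the two components of every jump. Then \<open>h \<circ> F\<close>
  has \<open>y\<close> as an orbit closing up modulo \<open>k\<close>, and the two orthogonal moves
  of length at most \<open>M\<close> displace a point by at most \<open>sqrt 2 * M\<close>.\<close>

lemma generic_periodic_pseudo_orbit_rotation_vector:
  assumes F: "inH area F" and st: "upper_stable area F eps" and eps: "eps < 1"
    and w: "w \<in> Zsq" "w \<noteq> 0" and w': "w' = (- snd w, fst w)"
    and q: "0 < q" and k: "k \<in> Zsq" and yq: "y q = y 0 + k"
    and gen: "\<And>i j. i < q \<Longrightarrow> j < q \<Longrightarrow> i \<noteq> j \<Longrightarrow> w \<bullet> y i - w \<bullet> y j \<notin> \<int>"
    and gen': "\<And>i j. i < q \<Longrightarrow> j < q \<Longrightarrow> i \<noteq> j \<Longrightarrow> w' \<bullet> F (y i) - w' \<bullet> F (y j) \<notin> \<int>"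
    and M: "0 \<le> M" "sqrt 2 * M < eps"
    and jump: "\<And>l. l < q \<Longrightarrow> \<bar>(y (Suc l) - F (y l)) \<bullet> w\<bar> \<le> M * norm w"
    and jump': "\<And>l. l < q \<Longrightarrow> \<bar>(y (Suc l) - F (y l)) \<bullet> w'\<bar> \<le> M * norm w"
  shows "(1 / real q) *\<^sub>R k \<in> rot_set F"
proof -
  define D where "D = w \<bullet> w"
  have nw: "0 < norm w" "D = norm w * norm w" "0 < D"
    using w(2) by (auto simp: D_def power2_norm_eq_inner[symmetric] power2_eq_square)
  have ww': "w \<bullet> w' = 0" "w' \<bullet> w = 0" "w' \<bullet> w' = D" "w' \<in> Zsq"
    using w(1) by (auto simp: w' D_def inner_prod_def Zsq_def)
  have cb: "\<bar>a / D\<bar> \<le> M / norm w" if "\<bar>a\<bar> \<le> M * norm w" for a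
    using that nw by (simp add: abs_mult field_simps)
  obtain \<phi> s where \<phi>: "continuous_on UNIV \<phi>" "\<And>x j. j \<in> \<int> \<Longrightarrow> \<phi> (x + j) = \<phi> x"
    "\<And>l. l < q \<Longrightarrow> \<phi> (w' \<bullet> F (y l)) = (y (Suc l) - F (y l)) \<bullet> w / D"
    "\<And>x. \<bar>\<phi> x\<bar> \<le> M / norm w" "\<phi> s = 0"
    by (rule periodic_interpolation[of q "\<lambda>l. w' \<bullet> F (y l)" "\<lambda>l. (y (Suc l) - F (y l)) \<bullet> w / D" "M / norm w"])
       (use gen' cb[OF jump] M(1) nw in auto)
  \<comment> \<open>The second shear acts where the jumps end, so its nodes are shifted by one
    index. As \<open>y q = y 0 + k\<close>, they agree modulo 1 with a cyclic permutation
    \<open>\<sigma>\<close> of the original nodes.\<close>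
  have genS: "w \<bullet> y (Suc i) - w \<bullet> y (Suc j) \<notin> \<int>" if ij: "i < q" "j < q" "i \<noteq> j" for i j
  proof -
    define \<sigma> where "\<sigma> = (\<lambda>i. if Suc i = q then 0 else Suc i)"
    have wk: "w \<bullet> k \<in> \<int>" using w(1) k by (auto simp: Zsq_def inner_prod_def)
    have s: "w \<bullet> y (Suc i) - w \<bullet> y (\<sigma> i) \<in> \<int>" "\<sigma> i < q" if "i < q" for i
      using that wk yq q by (auto simp: \<sigma>_def inner_add_right)
    have "\<sigma> i \<noteq> \<sigma> j" using ij by (auto simp: \<sigma>_def)
    then have ne: "w \<bullet> y (\<sigma> i) - w \<bullet> y (\<sigma> j) \<notin> \<int>" using gen s(2) ij by blast
    show ?thesis
    proof
      assume "w \<bullet> y (Suc i) - w \<bullet> y (Suc j) \<in> \<int>"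
      from Ints_add[OF Ints_diff[OF this s(1)[OF ij(1)]] s(1)[OF ij(2)]] ne
      show False by (simp add: algebra_simps)
    qed
  qed
  obtain \<psi> s' where \<psi>: "continuous_on UNIV \<psi>" "\<And>x j. j \<in> \<int> \<Longrightarrow> \<psi> (x + j) = \<psi> x"
    "\<And>l. l < q \<Longrightarrow> \<psi> (w \<bullet> y (Suc l)) = (y (Suc l) - F (y l)) \<bullet> w' / D"
    "\<And>x. \<bar>\<psi> x\<bar> \<le> M / norm w" "\<psi> s' = 0"
    by (rule periodic_interpolation[of q "\<lambda>l. w \<bullet> y (Suc l)" "\<lambda>l. (y (Suc l) - F (y l)) \<bullet> w' / D" "M / norm w"])
       (use genS cb[OF jump'] M(1) nw in auto)
  define h where "h = shear \<psi> w w' \<circ> shear \<phi> w' w"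
  have hH: "inH area h" unfolding h_def
    by (intro inH_comp inH_shear \<phi> \<psi> ww' w)
  have h_eq: "h z = z + \<phi> (w' \<bullet> z) *\<^sub>R w + \<psi> (w \<bullet> z + \<phi> (w' \<bullet> z) * D) *\<^sub>R w'" for z
    by (simp add: h_def shear_def inner_add_right D_def)
  have decomp: "(d \<bullet> w / D) *\<^sub>R w + (d \<bullet> w' / D) *\<^sub>R w' = d" for d
  proof -
    have "D *\<^sub>R ((d \<bullet> w / D) *\<^sub>R w + (d \<bullet> w' / D) *\<^sub>R w') = (d \<bullet> w) *\<^sub>R w + (d \<bullet> w') *\<^sub>R w'"
      using nw(3) by (simp add: scaleR_right_distrib)
    also have "\<dots> = D *\<^sub>R d"
      by (simp add: prod_eq_iff w' inner_prod_def D_def algebra_simps)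
    finally show ?thesis using nw(3) by (simp only: scaleR_cancel_left) auto
  qed
  \<comment> \<open>After the first shear the component along \<open>w\<close> is already that of
    \<open>y (Suc l)\<close>, so the second shear is evaluated exactly at its node.\<close>
  have hF: "h (F (y l)) = y (Suc l)" if l: "l < q" for l
  proof -
    have "w \<bullet> F (y l) + \<phi> (w' \<bullet> F (y l)) * D = w \<bullet> y (Suc l)"
      using nw(3) by (simp add: \<phi>(3)[OF l] inner_diff_left inner_diff_right inner_commute)
    then have "h (F (y l)) = F (y l) + (((y (Suc l) - F (y l)) \<bullet> w / D) *\<^sub>R w
        + ((y (Suc l) - F (y l)) \<bullet> w' / D) *\<^sub>R w')"
      unfolding h_eq by (simp only: \<phi>(3)[OF l] \<psi>(3)[OF l] add.assoc)
    then show ?thesis by (simp only: decomp) simp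
  qed
  have hd: "norm (z - h z) \<le> sqrt 2 * M" for z
  proof -
    define a b where "a = \<phi> (w' \<bullet> z)" and "b = \<psi> (w \<bullet> z + a * D)"
    have a: "\<bar>a\<bar> * norm w \<le> M" and b: "\<bar>b\<bar> * norm w \<le> M"
      using \<phi>(4) \<psi>(4) nw(1) by (simp_all add: a_def b_def pos_le_divide_eq)
    have "(norm (z - h z))\<^sup>2 = (a *\<^sub>R w + b *\<^sub>R w') \<bullet> (a *\<^sub>R w + b *\<^sub>R w')"
      unfolding norm_minus_commute[of z] by (simp add: h_eq power2_norm_eq_inner a_def b_def)
    also have "\<dots> = (\<bar>a\<bar> * norm w)\<^sup>2 + (\<bar>b\<bar> * norm w)\<^sup>2"
      by (simp add: inner_add_left inner_add_right ww' D_def[symmetric] nw(2) power_mult_distrib)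
         (simp add: power2_eq_square)
    also have "\<dots> \<le> M\<^sup>2 + M\<^sup>2"
      using a b by (intro add_mono power_mono) auto
    also have "\<dots> = (sqrt 2 * M)\<^sup>2" by (simp add: power_mult_distrib)
    finally show ?thesis by (rule power2_le_imp_le) (use M(1) in simp)
  qed
  \<comment> \<open>Both interpolating functions vanish here, so \<open>h\<close> fixes
    \<open>z0\<close>, and \<open>F\<close> and \<open>h \<circ> F\<close> coincide at the preimage
    of \<open>z0\<close> under \<open>F\<close>. This singles out the right lift.\<close>
  define z0 where "z0 = (s' / D) *\<^sub>R w + (s / D) *\<^sub>R w'"
  have "w \<bullet> z0 = s'" "w' \<bullet> z0 = s"
    using nw(3) by (auto simp: z0_def inner_add_right ww' D_def[symmetric])
  then have hz0: "h z0 = z0" by (simp add: h_eq \<phi>(5) \<psi>(5))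
  have FL: "torus_lift F" using F by (simp add: inH_def)
  then obtain F' where "homeomorphism UNIV UNIV F F'" by (auto simp: torus_lift_def)
  then have "F (F' z0) = z0" by (simp add: homeomorphism_apply2)
  define G where "G = h \<circ> F"
  have G: "inH area G" unfolding G_def by (rule inH_comp[OF hH F])
  have "rot_set G \<subseteq> rot_set F"
  proof (rule upper_stable_rot_set_subset[OF st eps G _ M(2)])
    show "norm (F x - G x) \<le> sqrt 2 * M" for x using hd by (simp add: G_def)
    show "F (F' z0) = G (F' z0)" using \<open>F (F' z0) = z0\<close> hz0 by (simp add: G_def)
  qed
  moreover have "(G ^^ l) (y 0) = y l" if "l \<le> q" for l
    using that by (induction l) (auto simp: G_def hF)
  then have "(1 / real q) *\<^sub>R k \<in> rot_set G"
    using G q k yq by (intro periodic_point_rotation_vector[of G k q "y 0"]) (auto simp: inH_def)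
  ultimately show ?thesis by blast
qed

lemma finite_strict_bound:
  fixes f :: "nat \<Rightarrow> real"
  assumes "\<And>l. l < q \<Longrightarrow> f l < c" "0 < c"
  obtains M where "0 \<le> M" "M < c" "\<And>l. l < q \<Longrightarrow> f l \<le> M"
proof -
  define M where "M = Max (insert 0 (f ` {..<q}))"
  have "M \<in> insert 0 (f ` {..<q})" unfolding M_def by (rule Max_in) auto
  then have "M < c" using assms by auto
  moreover have "f l \<le> M" if "l < q" for l unfolding M_def using that by (intro Max_ge) auto
  moreover have "0 \<le> M" unfolding M_def by (intro Max_ge) auto
  ultimately show ?thesis using that by blast
qed

text \<open>Jumps below \<open>eps / 2\<close> have components below \<open>eps / sqrt 2\<close> in
  every orthogonal frame, so the frame can be adapted to the one larger jump. The finitely many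
  strict inequalities leave slack for a perturbation to generic position.\<close>

lemma periodic_pseudo_orbit_rotation_vector:
  assumes F: "inH area F" and st: "upper_stable area F eps" and eps: "0 < eps" "eps < 1"
    and q: "0 < q" and k: "k \<in> Zsq" and yq: "y q = y 0 + k"
    and jump: "\<And>l. Suc l < q \<Longrightarrow> norm (F (y l) - y (Suc l)) < eps / 2"
    and last: "\<And>l. Suc l = q \<Longrightarrow> norm (F (y l) - y q) < eps"
  shows "(1 / real q) *\<^sub>R k \<in> rot_set F"
proof -
  define e where "e = (\<lambda>l. y (Suc l) - F (y l))"
  have "norm (e (q - 1)) < eps"
    using last[of "q - 1"] q by (simp add: e_def norm_minus_commute)
  then obtain w where w: "w \<in> Zsq" "w \<noteq> 0" "sqrt 2 * \<bar>e (q - 1) \<bullet> w\<bar> < eps * norm w"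
    "sqrt 2 * \<bar>e (q - 1) \<bullet> (- snd w, fst w)\<bar> < eps * norm w"
    by (rule diagonal_lattice_direction)
  define w' where "w' = (- snd w, fst w)"
  have "norm w' = norm w" by (simp add: w'_def norm_prod_def add.commute)
  then have nw: "0 < norm w" "norm w' = norm w" "w' \<noteq> 0" using w(2) by auto
  have lt: "max \<bar>e l \<bullet> w\<bar> \<bar>e l \<bullet> w'\<bar> / norm w < eps / sqrt 2" if l: "l < q" for l
  proof -
    have "sqrt 2 * \<bar>e l \<bullet> u\<bar> < eps * norm w" if u: "u = w \<or> u = w'" for u
    proof (cases "Suc l = q")
      case True
      then have "l = q - 1" by simp
      then show ?thesis using w(3,4) u unfolding w'_def[symmetric] by blast
    next
      case False
      then have "norm (e l) < eps / 2"
        using jump[of l] l by (simp add: e_def norm_minus_commute)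
      have nu: "norm u = norm w" using u nw by auto
      have "sqrt 2 * \<bar>e l \<bullet> u\<bar> \<le> 2 * (norm (e l) * norm u)"
        by (intro mult_mono Cauchy_Schwarz_ineq2 real_le_lsqrt) auto
      also have "\<dots> < 2 * (eps / 2 * norm u)"
        using \<open>norm (e l) < eps / 2\<close> nw nu by (intro mult_strict_left_mono mult_strict_right_mono) auto
      finally show ?thesis by (simp add: nu)
    qed
    from this[of w] this[of w'] show ?thesis
      using nw(1) by (simp add: field_simps max_def)
  qed
  obtain M where M: "0 \<le> M" "M < eps / sqrt 2"
    "\<And>l. l < q \<Longrightarrow> max \<bar>e l \<bullet> w\<bar> \<bar>e l \<bullet> w'\<bar> / norm w \<le> M"
    by (rule finite_strict_bound[of q "\<lambda>l. max \<bar>e l \<bullet> w\<bar> \<bar>e l \<bullet> w'\<bar> / norm w" "eps / sqrt 2"])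
       (use lt eps(1) in auto)
  \<comment> \<open>Half of the slack. Moving the points by less than \<open>d0\<close> changes each
    jump by at most \<open>\<eta>\<close>: \<open>\<eta> / 2\<close> through \<open>F\<close> at its
    start and \<open>\<eta> / 2\<close> at its end.\<close>
  define \<eta> where "\<eta> = (eps / sqrt 2 - M) / 2"
  have "0 < (c - M) / 2 \<and> M + (c - M) / 2 < c" if "M < c" for c using that by (simp add: field_simps)
  then have \<eta>: "0 < \<eta>" "M + \<eta> < eps / sqrt 2" using M(2) unfolding \<eta>_def by blast+
  have FL: "torus_lift F" using F by (simp add: inH_def)
  have "isCont F z" for z
    using torus_lift_continuous[OF FL, of UNIV] continuous_on_eq_continuous_at[OF open_UNIV, of F]
    by blast
  then have "\<exists>d>0. \<forall>p. dist p (y l) < d \<longrightarrow> dist (F p) (F (y l)) < \<eta> / 2" for l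
    using \<eta>(1) unfolding continuous_at_eps_delta by (metis half_gt_zero)
  then obtain d where d: "\<And>l. 0 < d l" "\<And>l p. dist p (y l) < d l \<Longrightarrow> dist (F p) (F (y l)) < \<eta> / 2"
    by metis
  define d0 where "d0 = Min (insert (\<eta> / 2) (d ` {..<q}))"
  have d0_le: "d0 \<le> v" if "v \<in> insert (\<eta> / 2) (d ` {..<q})" for v
    unfolding d0_def using that by (intro Min_le) auto
  have "d0 \<in> insert (\<eta> / 2) (d ` {..<q})" unfolding d0_def by (rule Min_in) auto
  then have d0: "0 < d0" "d0 \<le> \<eta> / 2" "\<And>l. l < q \<Longrightarrow> d0 \<le> d l"
    using \<eta>(1) d(1) d0_le[of "\<eta> / 2"] d0_le by auto
  obtain x where x: "\<And>l. l < q \<Longrightarrow> norm (x l - y l) < d0"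
    "\<And>i j. i < q \<Longrightarrow> j < q \<Longrightarrow> i \<noteq> j \<Longrightarrow> w \<bullet> x i - w \<bullet> x j \<notin> \<int>"
    "\<And>i j. i < q \<Longrightarrow> j < q \<Longrightarrow> i \<noteq> j \<Longrightarrow> w' \<bullet> F (x i) - w' \<bullet> F (x j) \<notin> \<int>"
    using generic_perturbation[OF FL w(2) nw(3) d0(1)] by blast
  \<comment> \<open>The last point moves together with the first, so that the sequence still closes
    up modulo \<open>k\<close>.\<close>
  define y' where "y' = x(q := x 0 + k)"
  have y'x: "y' l = x l" if "l < q" for l using that by (simp add: y'_def)
  have y': "norm (y' l - y l) < d0" if "l \<le> q" for l
    using x(1)[of l] x(1)[of 0] that q by (cases "l = q") (auto simp: y'_def yq)
  have near: "\<bar>(y' (Suc l) - F (y' l)) \<bullet> u\<bar> \<le> (M + \<eta>) * norm w"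
    if l: "l < q" and u: "u = w \<or> u = w'" for l u
  proof -
    have nu: "norm u = norm w" using u nw by auto
    have "\<bar>e l \<bullet> u\<bar> \<le> M * norm w"
      using M(3)[OF l] nw(1) u by (auto simp: field_simps)
    have "norm (F (y' l) - F (y l)) < \<eta> / 2"
      using d(2)[of "y' l" l] y'[of l] d0(3)[OF l] l by (simp add: dist_norm)
    moreover have "norm (y' (Suc l) - y (Suc l)) < \<eta> / 2"
      using y'[of "Suc l"] d0(2) l by linarith
    ultimately have "norm ((y' (Suc l) - y (Suc l)) - (F (y' l) - F (y l))) \<le> \<eta>"
      using norm_triangle_ineq4[of "y' (Suc l) - y (Suc l)" "F (y' l) - F (y l)"] by linarith
    then have "\<bar>((y' (Suc l) - y (Suc l)) - (F (y' l) - F (y l))) \<bullet> u\<bar> \<le> \<eta> * norm w"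
      using Cauchy_Schwarz_ineq2 nu by (metis mult_right_mono norm_ge_zero order_trans)
    moreover have "(y' (Suc l) - F (y' l)) \<bullet> u
        = ((y' (Suc l) - y (Suc l)) - (F (y' l) - F (y l))) \<bullet> u + e l \<bullet> u"
      by (simp add: e_def inner_diff_left)
    ultimately show ?thesis using \<open>\<bar>e l \<bullet> u\<bar> \<le> M * norm w\<close>
      by (simp only: distrib_right)
  qed
  show ?thesis
  proof (rule generic_periodic_pseudo_orbit_rotation_vector[OF F st eps(2) w(1,2) w'_def q k])
    show "y' q = y' 0 + k" using q by (simp add: y'_def)
    show "0 \<le> M + \<eta>" using M(1) \<eta>(1) by simp
    show "sqrt 2 * (M + \<eta>) < eps" using \<eta>(2) by (simp add: field_simps)
  qed (use near x(2,3) y'x in auto)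
qed

section \<open>Deviation of pseudo-orbits\<close>

text \<open>Balls of radius \<open>d / 2\<close> about the points are disjoint on the torus, whose
  area is 1. In the plane this is seen on \<open>L * L\<close> integer translates, which lie in a
  square of side \<open>L\<close> plus a constant, as \<open>L\<close> tends to infinity;
  \<open>d < 1\<close> separates the translates of a single ball.\<close>

lemma torus_packing:
  fixes S :: "(real \<times> real) set"
  assumes S: "finite S" and d: "0 < d" "d < 1"
    and sep: "\<And>a b k. a \<in> S \<Longrightarrow> b \<in> S \<Longrightarrow> a \<noteq> b \<Longrightarrow> k \<in> Zsq \<Longrightarrow> d \<le> norm (a - b - k)"
  shows "real (card S) \<le> 4 / (pi * d\<^sup>2)"
proof -
  define r where "r = d / 2"
  obtain R where R: "0 < R" "\<And>x. x \<in> S \<Longrightarrow> norm x \<le> R"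
    using finite_imp_bounded[OF S] bounded_pos by metis
  have ball_area: "measure lborel (ball c r :: (real \<times> real) set) = pi * r\<^sup>2" for c
    using d(1) by (simp add: content_ball r_def unit_ball_vol_2 power2_eq_square)
  have main: "real (card S) * (pi * r\<^sup>2) \<le> ((real L + (2 * R + 2)) / real L)\<^sup>2" if L: "0 < L" for L :: nat
  proof -
    define I where "I = S \<times> ({..<L} \<times> {..<L})"
    define A where "A = (\<lambda>(x, i, j). ball (x + (real i, real j)) r)"
    have "disjoint_family_on A I"
      unfolding disjoint_family_on_def
    proof (intro ballI impI, rule ccontr)
      fix a b assume ab: "a \<in> I" "b \<in> I" "a \<noteq> b" "A a \<inter> A b \<noteq> {}"
      obtain x i j where a: "a = (x, i, j)" by (cases a)
      obtain y i' j' where b: "b = (y, i', j')" by (cases b)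
      define k where "k = (real i' - real i, real j' - real j)"
      have k: "k \<in> Zsq" by (simp add: k_def Zsq_def)
      obtain p where p: "dist (x + (real i, real j)) p < r" "dist (y + (real i', real j')) p < r"
        using ab(4) by (auto simp: A_def a b)
      then have "dist (x + (real i, real j)) (y + (real i', real j')) < d"
        using dist_triangle2[of "x + (real i, real j)" "y + (real i', real j')" p]
        by (simp add: r_def)
      moreover have "x + (real i, real j) - (y + (real i', real j')) = x - y - k"
        by (simp add: k_def prod_eq_iff)
      ultimately have lt: "norm (x - y - k) < d" by (simp only: dist_norm)
      then have "x = y" using sep[OF _ _ _ k, of x y] ab(1,2) a b by (force simp: I_def)
      moreover have "k = 0"
        using Zsq_norm_ge_1[OF k] lt d(2) \<open>x = y\<close> by force
      ultimately show False using ab(3) by (simp add: a b k_def zero_prod_def)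
    qed
    moreover have fin: "emeasure lborel (A a) \<noteq> \<infinity>" for a
      using emeasure_lborel_ball_finite unfolding A_def by (cases a) (simp add: less_top)
    moreover have "finite I" using S by (simp add: I_def)
    ultimately have "measure lborel (\<Union>a\<in>I. A a) = (\<Sum>a\<in>I. measure lborel (A a))"
      by (intro measure_finite_Union fin) (auto simp: A_def)
    also have "\<dots> = (\<Sum>a\<in>I. pi * r\<^sup>2)"
      by (intro sum.cong refl) (auto simp: A_def ball_area)
    also have "\<dots> = real (card S) * (pi * r\<^sup>2) * (real L)\<^sup>2"
      by (simp add: I_def card_cartesian_product power2_eq_square)
    finally have "real (card S) * (pi * r\<^sup>2) * (real L)\<^sup>2 = measure lborel (\<Union>a\<in>I. A a)" ..
    also have "\<dots> \<le> measure lborel (cbox (- (R + 1), - (R + 1)) (real L + R + 1, real L + R + 1))"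
    proof (rule measure_mono_fmeasurable)
      show "(\<Union>a\<in>I. A a) \<subseteq> cbox (- (R + 1), - (R + 1)) (real L + R + 1, real L + R + 1)"
      proof
        fix p assume "p \<in> (\<Union>a\<in>I. A a)"
        then obtain x i j where x: "x \<in> S" "i < L" "j < L" "dist (x + (real i, real j)) p < r"
          by (auto simp: A_def I_def)
        have "\<bar>fst x\<bar> \<le> R" "\<bar>snd x\<bar> \<le> R"
          using R(2)[OF x(1)] norm_fst_le[of "fst x" "snd x"] norm_snd_le[of "snd x" "fst x"] by auto
        moreover have "\<bar>fst x + real i - fst p\<bar> < 1" "\<bar>snd x + real j - snd p\<bar> < 1"
          using dist_fst_le[of "x + (real i, real j)" p] dist_snd_le[of "x + (real i, real j)" p] x(4) d(2)
          by (auto simp: dist_real_def r_def)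
        moreover have "real i < real L" "real j < real L" using x(2,3) by auto
        ultimately have "- (R + 1) \<le> fst p" "- (R + 1) \<le> snd p" "fst p \<le> real L + R + 1"
          "snd p \<le> real L + R + 1" by linarith+
        then show "p \<in> cbox (- (R + 1), - (R + 1)) (real L + R + 1, real L + R + 1)"
          by (cases p) (auto simp: cbox_Pair_eq)
      qed
      show "(\<Union>a\<in>I. A a) \<in> sets lborel"
        using \<open>finite I\<close> by (intro sets.finite_UN) (auto simp: A_def)
    qed (simp add: fmeasurable_cbox)
    also have "\<dots> = (real L + (2 * R + 2))\<^sup>2"
      using R(1) by (simp add: content_Pair power2_eq_square algebra_simps)
    finally show ?thesis using L by (simp add: power_divide pos_le_divide_eq)
  qed
  have "(\<lambda>L. ((real L + (2 * R + 2)) / real L)\<^sup>2) \<longlonglongrightarrow> 1\<^sup>2"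
  proof (intro tendsto_power)
    have "(\<lambda>L. 1 + (2 * R + 2) / real L) \<longlonglongrightarrow> 1 + 0"
      by (intro tendsto_add tendsto_const lim_const_over_n)
    moreover have "eventually (\<lambda>L. 1 + (2 * R + 2) / real L = (real L + (2 * R + 2)) / real L) sequentially"
      using eventually_gt_at_top[of "0::nat"] by eventually_elim (simp add: field_simps)
    ultimately show "(\<lambda>L. (real L + (2 * R + 2)) / real L) \<longlonglongrightarrow> 1"
      by (simp add: tendsto_cong)
  qed
  moreover have "eventually (\<lambda>L. real (card S) * (pi * r\<^sup>2) \<le> ((real L + (2 * R + 2)) / real L)\<^sup>2) sequentially"
    using eventually_gt_at_top[of "0::nat"] by eventually_elim (rule main)
  ultimately have "real (card S) * (pi * r\<^sup>2) \<le> 1\<^sup>2" by (rule tendsto_lowerbound) simp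
  then show ?thesis using d(1) by (simp add: r_def field_simps power2_eq_square)
qed

section \<open>Cutting a sequence into nearly closed blocks\<close>

text \<open>Lets the displacements of consecutive blocks be added, the weights being their numbers
  of steps.\<close>

lemma convex_scaled_add:
  assumes "convex R" "v \<in> R" "v' \<in> R" "0 \<le> a" "0 \<le> (b::real)"
  shows "\<exists>u\<in>R. a *\<^sub>R v + b *\<^sub>R v' = (a + b) *\<^sub>R u"
proof (cases "a + b = 0")
  case True
  then have "a = 0" "b = 0" using assms(4,5) by auto
  then show ?thesis using assms(2) by auto
next
  case False
  have "(a / (a + b)) *\<^sub>R v + (b / (a + b)) *\<^sub>R v' \<in> R"
    using assms False by (intro convexD) (auto simp: add_divide_distrib[symmetric])
  then show ?thesis using False
    by (intro bexI[of _ "(a / (a + b)) *\<^sub>R v + (b / (a + b)) *\<^sub>R v'"]) (auto simp: scaleR_right_distrib)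
qed

text \<open>From \<open>x i\<close>, jump to the last time \<open>j\<close> at which the sequence is close to \<open>x i\<close> modulo the
  lattice, make one step, and repeat. The starting points of these blocks are separated.\<close>

lemma block_decomposition:
  fixes x :: "nat \<Rightarrow> real \<times> real"
  assumes R: "convex R" "R \<noteq> {}" and d: "0 < d" and s: "0 \<le> s"
    and loop: "\<And>i j k. i < j \<Longrightarrow> j \<le> n \<Longrightarrow> k \<in> Zsq \<Longrightarrow> norm (x j - x i - k) < d \<Longrightarrow>
      (1 / real (j - i)) *\<^sub>R k \<in> R"
    and step: "\<And>i v. i < n \<Longrightarrow> v \<in> R \<Longrightarrow> norm (x (Suc i) - x i - v) \<le> s"
    and i: "i \<le> n"
  shows "\<exists>T w. T \<subseteq> {i..n} \<and> (\<forall>a\<in>T. \<forall>b\<in>T. a \<noteq> b \<longrightarrow> (\<forall>k\<in>Zsq. d \<le> norm (x a - x b - k))) \<and>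
    w \<in> R \<and> norm (x n - x i - real (n - i) *\<^sub>R w) \<le> real (card T) * (d + s)"
  using i
proof (induction "n - i" arbitrary: i rule: less_induct)
  case less
  define J where "J = {j\<in>{i..n}. \<exists>k\<in>Zsq. norm (x j - x i - k) < d}"
  have "finite J" "i \<in> J" using less.prems d by (auto simp: J_def intro!: bexI[of _ 0])
  define j where "j = Max J"
  have "j \<in> J" using \<open>finite J\<close> \<open>i \<in> J\<close> unfolding j_def by (intro Max_in) auto
  then have j: "i \<le> j" "j \<le> n" by (auto simp: J_def)
  have far: "d \<le> norm (x b - x i - k)" if "j < b" "b \<le> n" "k \<in> Zsq" for b k
  proof (rule ccontr)
    assume "\<not> d \<le> norm (x b - x i - k)"
    then have "b \<in> J" using that j unfolding J_def by force
    then show False using Max_ge[OF \<open>finite J\<close>] that(1) unfolding j_def by fastforce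
  qed
  \<comment> \<open>A block that returns near its start is within \<open>d\<close> of
    \<open>k\<close>, which is \<open>j - i\<close> times an element of \<open>R\<close> by
    \<open>loop\<close>. A block of length 0 admits any element of \<open>R\<close>.\<close>
  obtain u where u: "u \<in> R" "norm (x j - x i - real (j - i) *\<^sub>R u) < d"
  proof (cases "i = j")
    case True
    then show ?thesis using that R(2) d by auto
  next
    case False
    obtain k where k: "k \<in> Zsq" "norm (x j - x i - k) < d" using \<open>j \<in> J\<close> by (auto simp: J_def)
    then show ?thesis
      using that[of "(1 / real (j - i)) *\<^sub>R k"] loop[of i j k] False j by simp
  qed
  show ?case
  proof (cases "j = n")
    case True
    have "norm (x n - x i - real (n - i) *\<^sub>R u) \<le> real (card {i}) * (d + s)"
      using u(2) s True by simp
    then show ?thesis using u(1) less.prems by (intro exI[of _ "{i}"] exI[of _ u]) auto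
  next
    case False
    then have jn: "j < n" using j by simp
    obtain T w where T: "T \<subseteq> {Suc j..n}"
      "\<And>a b k. a \<in> T \<Longrightarrow> b \<in> T \<Longrightarrow> a \<noteq> b \<Longrightarrow> k \<in> Zsq \<Longrightarrow> d \<le> norm (x a - x b - k)"
      "w \<in> R" "norm (x n - x (Suc j) - real (n - Suc j) *\<^sub>R w) \<le> real (card T) * (d + s)"
    proof -
      have "n - Suc j < n - i" "Suc j \<le> n" using jn j by auto
      from less.hyps[OF this] show ?thesis using that by blast
    qed
    have "finite T" "i \<notin> T" using T(1) j finite_subset by auto
    \<comment> \<open>Three pieces are merged: the remainder from \<open>Suc j\<close>, the single
      step from \<open>j\<close> (compared with the same \<open>u\<close>, at cost
      \<open>s\<close>), and the block from \<open>i\<close> to \<open>j\<close>.\<close>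
    obtain w1 where w1: "w1 \<in> R" "real (n - Suc j) *\<^sub>R w + 1 *\<^sub>R u = (real (n - Suc j) + 1) *\<^sub>R w1"
      using convex_scaled_add[OF R(1) T(3) u(1), of "real (n - Suc j)" 1] by auto
    obtain w2 where w2: "w2 \<in> R"
      "(real (n - Suc j) + 1) *\<^sub>R w1 + real (j - i) *\<^sub>R u = (real (n - Suc j) + 1 + real (j - i)) *\<^sub>R w2"
      using convex_scaled_add[OF R(1) w1(1) u(1), of "real (n - Suc j) + 1" "real (j - i)"] by auto
    have "real (n - Suc j) + 1 + real (j - i) = real (n - i)" using jn j by linarith
    then have eq: "real (n - i) *\<^sub>R w2 = real (n - Suc j) *\<^sub>R w + u + real (j - i) *\<^sub>R u"
      using w1(2) w2(2) by simp
    have "x n - x i - real (n - i) *\<^sub>R w2 = (x n - x (Suc j) - real (n - Suc j) *\<^sub>R w)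
        + ((x (Suc j) - x j - u) + (x j - x i - real (j - i) *\<^sub>R u))"
      unfolding eq by simp
    then have "norm (x n - x i - real (n - i) *\<^sub>R w2) \<le> norm (x n - x (Suc j) - real (n - Suc j) *\<^sub>R w)
        + (norm (x (Suc j) - x j - u) + norm (x j - x i - real (j - i) *\<^sub>R u))"
      by (simp only: order_trans[OF norm_triangle_ineq add_left_mono[OF norm_triangle_ineq]])
    also have "\<dots> \<le> real (card T) * (d + s) + (s + d)"
      using T(4) u step[OF jn u(1)] by (intro add_mono) auto
    finally have "norm (x n - x i - real (n - i) *\<^sub>R w2) \<le> real (card (insert i T)) * (d + s)"
      using \<open>finite T\<close> \<open>i \<notin> T\<close> by (simp add: algebra_simps)
    moreover have "insert i T \<subseteq> {i..n}" using T(1) j less.prems by auto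
    moreover have "d \<le> norm (x a - x b - k)"
      if ab: "a \<in> insert i T" "b \<in> insert i T" "a \<noteq> b" "k \<in> Zsq" for a b k
    proof -
      have fwd: "d \<le> norm (x b - x i - k)" if "b \<in> T" "k \<in> Zsq" for b k
        using far[of b k] that T(1) by auto
      moreover have "d \<le> norm (x i - x b - k)" if "b \<in> T" "k \<in> Zsq" for b k
      proof -
        have "d \<le> norm (x b - x i - - k)" by (rule fwd[OF that(1) Zsq_uminus[OF that(2)]])
        moreover have "x b - x i - - k = - (x i - x b - k)" by simp
        ultimately show ?thesis by (simp only: norm_minus_cancel)
      qed
      ultimately show ?thesis using ab T(2) by blast
    qed
    ultimately show ?thesis using w2(1) by (intro exI[of _ "insert i T"] exI[of _ w2]) blast
  qed
qed

text \<open>Treats both bounds at once: \<open>d\<close> is the closeness that ends a block and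
  \<open>e\<close> the jump size, and \<open>d + e \<le> eps\<close> controls the jump closing a
  loop. The equality alternative in \<open>jump\<close> admits true orbits with
  \<open>e = 0\<close>. Each of the at most \<open>4 / (pi * d\<^sup>2)\<close> blocks costs
  \<open>d + osc F + e\<close>, hence at most \<open>osc F + 1\<close>.\<close>

lemma rot_set_deviation:
  fixes x :: "nat \<Rightarrow> real \<times> real"
  assumes F: "inH area F" and st: "upper_stable area F eps" and eps: "0 < eps" "eps < 1"
    and d: "0 < d" "d + e \<le> eps" and e: "0 \<le> e" "e \<le> eps / 2"
    and jump: "\<And>i. i < n \<Longrightarrow> F (x i) = x (Suc i) \<or> norm (F (x i) - x (Suc i)) < e"
  shows "\<exists>w\<in>rot_set F. norm (x n - x 0 - real n *\<^sub>R w) \<le> 4 / (pi * d\<^sup>2) * (osc F + 1)"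
proof -
  have FL: "torus_lift F" using F by (simp add: inH_def)
  have osc0: "0 \<le> osc F" using osc_upper[OF FL] norm_ge_zero order_trans by blast
  have le: "norm (F (x i) - x (Suc i)) \<le> e" if "i < n" for i
    using jump[OF that] e(1) by auto
  have loop: "(1 / real (j - i)) *\<^sub>R k \<in> rot_set F"
    if ij: "i < j" "j \<le> n" and k: "k \<in> Zsq" and close: "norm (x j - x i - k) < d" for i j k
  \<comment> \<open>The block is closed by replacing its end \<open>x j\<close> with
    \<open>x i + k\<close>. Only the last jump changes, and it stays below
    \<open>e + d\<close>.\<close>
  proof (rule periodic_pseudo_orbit_rotation_vector[OF F st eps _ k,
      where y="\<lambda>l. if l = j - i then x i + k else x (i + l)"])
    show "0 < j - i" using ij by simp
    show "(if j - i = j - i then x i + k else x (i + (j - i))) = (if 0 = j - i then x i + k else x (i + 0)) + k"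
      using ij by simp
    show "norm (F (if l = j - i then x i + k else x (i + l)) - (if Suc l = j - i then x i + k else x (i + Suc l))) < eps / 2"
      if "Suc l < j - i" for l
    proof -
      have "i + l < n" using that ij by simp
      then show ?thesis using jump[of "i + l"] that eps e(2) by auto
    qed
    show "norm (F (if l = j - i then x i + k else x (i + l)) - (if j - i = j - i then x i + k else x (i + (j - i)))) < eps"
      if l: "Suc l = j - i" for l
    proof -
      have il: "Suc (i + l) = j" using l ij by simp
      then have "norm (F (x (i + l)) - x j) \<le> e" using le[of "i + l"] ij by simp
      moreover have "F (x (i + l)) - (x i + k) = (F (x (i + l)) - x j) + (x j - x i - k)" by simp
      ultimately have "norm (F (x (i + l)) - (x i + k)) < e + d"
        using close norm_triangle_ineq[of "F (x (i + l)) - x j" "x j - x i - k"] by (simp only:)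
      then show ?thesis using l d(2) by simp
    qed
  qed
  have step: "norm (x (Suc i) - x i - v) \<le> osc F + e" if "i < n" "v \<in> rot_set F" for i v
  proof -
    have "x (Suc i) - x i - v = (F (x i) - x i - v) - (F (x i) - x (Suc i))" by simp
    then show ?thesis
      using norm_triangle_ineq4[of "F (x i) - x i - v" "F (x i) - x (Suc i)"] le[OF that(1)]
        displacement_near_rot_set[OF FL that(2), of "x i"] by (simp only:)
  qed
  obtain T w where T: "T \<subseteq> {0..n}"
    "\<And>a b k. a \<in> T \<Longrightarrow> b \<in> T \<Longrightarrow> a \<noteq> b \<Longrightarrow> k \<in> Zsq \<Longrightarrow> d \<le> norm (x a - x b - k)"
    and w: "w \<in> rot_set F" "norm (x n - x 0 - real (n - 0) *\<^sub>R w) \<le> real (card T) * (d + (osc F + e))"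
  proof -
    have "0 \<le> osc F + e" using osc0 e(1) by simp
    from block_decomposition[where R="rot_set F" and n=n and x=x and i=0, OF convex_rot_set[OF FL]
        rot_set_nonempty[OF FL] d(1) this loop step]
    show ?thesis using that by blast
  qed
  \<comment> \<open>Separation with \<open>k = 0\<close> makes the points distinct, so counting
    indices is counting points of the packing.\<close>
  have "inj_on x T"
  proof (rule inj_onI, rule ccontr)
    fix a b assume "a \<in> T" "b \<in> T" "x a = x b" "a \<noteq> b"
    then show False using T(2)[of a b 0] d(1) by simp
  qed
  then have "real (card T) = real (card (x ` T))" by (simp add: card_image)
  also have "\<dots> \<le> 4 / (pi * d\<^sup>2)"
  proof (rule torus_packing)
    show "finite (x ` T)" using T(1) finite_subset by blast
    show "d < 1" using d(2) e(1) eps(2) by linarith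
    show "d \<le> norm (a - b - k)" if "a \<in> x ` T" "b \<in> x ` T" "a \<noteq> b" "k \<in> Zsq" for a b k
      using that T(2) by blast
  qed (rule d(1))
  finally have "real (card T) * (d + (osc F + e)) \<le> 4 / (pi * d\<^sup>2) * (osc F + 1)"
    using osc0 d e eps by (intro mult_mono) auto
  then show ?thesis using w by (intro bexI[of _ w]) auto
qed

section \<open>Pseudo-rotation sets and the final bounds\<close>

lemma rot_set_subset_pseudo_rot_set:
  assumes "0 < e"
  shows "rot_set F \<subseteq> pseudo_rot_set e F"
proof
  fix v assume "v \<in> rot_set F"
  then obtain z n where n: "filterlim n at_top sequentially"
    "(\<lambda>k. (1 / real (n k)) *\<^sub>R ((F ^^ n k) (z k) - z k)) \<longlonglongrightarrow> v"
    unfolding rot_set_def by blast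
  then show "v \<in> pseudo_rot_set e F"
    unfolding pseudo_rot_set_def pseudo_orbit_upto_def using assms
    by (intro CollectI exI[of _ n] exI[of _ "\<lambda>k i. (F ^^ i) (z k)"]) simp
qed

text \<open>The deviation \<open>C\<close> does not depend on the length, so after division by
  \<open>n k\<close> the vectors \<open>w k\<close> in \<open>R\<close> have the same limit as the
  averages.\<close>

lemma pseudo_rot_set_subset_if_bounded_deviation:
  assumes R: "closed R"
    and dev: "\<And>n x. pseudo_orbit_upto F e n x \<Longrightarrow> \<exists>w\<in>R. norm (x n - x 0 - real n *\<^sub>R w) \<le> C"
  shows "pseudo_rot_set e F \<subseteq> R"
proof
  fix v assume "v \<in> pseudo_rot_set e F"
  then obtain n x where n: "filterlim n at_top sequentially"
    and x: "\<And>k. pseudo_orbit_upto F e (n k) (x k)"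
    and lim: "(\<lambda>k. (1 / real (n k)) *\<^sub>R (x k (n k) - x k 0)) \<longlonglongrightarrow> v"
    unfolding pseudo_rot_set_def by blast
  have "\<exists>w\<in>R. norm (x k (n k) - x k 0 - real (n k) *\<^sub>R w) \<le> C" for k by (rule dev[OF x])
  then obtain w where w: "\<And>k. w k \<in> R" "\<And>k. norm (x k (n k) - x k 0 - real (n k) *\<^sub>R w k) \<le> C"
    by metis
  have bound: "norm (w k - (1 / real (n k)) *\<^sub>R (x k (n k) - x k 0)) \<le> C / real (n k)" if "0 < n k" for k
  proof -
    have "w k - (1 / real (n k)) *\<^sub>R (x k (n k) - x k 0)
        = - ((1 / real (n k)) *\<^sub>R (x k (n k) - x k 0 - real (n k) *\<^sub>R w k))"
      using that by (simp add: scaleR_right_diff_distrib)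
    then have "norm (w k - (1 / real (n k)) *\<^sub>R (x k (n k) - x k 0))
        = norm (x k (n k) - x k 0 - real (n k) *\<^sub>R w k) / real (n k)"
      by (simp only: norm_minus_cancel norm_scaleR) simp
    then show ?thesis using w(2)[of k] by (simp add: divide_right_mono)
  qed
  have "eventually (\<lambda>k. 0 < n k) sequentially"
    by (rule eventually_compose_filterlim[OF eventually_gt_at_top n])
  then have "eventually (\<lambda>k. norm (w k - (1 / real (n k)) *\<^sub>R (x k (n k) - x k 0)) \<le> C / real (n k)) sequentially"
    by (rule eventually_mono) (rule bound)
  moreover have "(\<lambda>k. C / real (n k)) \<longlonglongrightarrow> 0"
    by (rule filterlim_compose[OF lim_const_over_n n])
  ultimately have "(\<lambda>k. w k - (1 / real (n k)) *\<^sub>R (x k (n k) - x k 0)) \<longlonglongrightarrow> 0"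
    by (rule Lim_null_comparison)
  from tendsto_add[OF this lim] have "w \<longlonglongrightarrow> v" by (simp only: diff_add_cancel add_0)
  then show "v \<in> R" using closed_sequentially[OF R] w(1) by blast
qed

theorem theorem3p2:
  fixes area :: bool and F :: "real \<times> real \<Rightarrow> real \<times> real" and eps :: real
  assumes "inH area F"
    and "0 < eps" and "eps < 1"
    and "upper_stable area F eps"
  shows "pseudo_rot_set (eps / 2) F = rot_set F
    \<and> (\<forall>x. pseudo_orbit F (eps / 2) x \<longrightarrow>
         (\<forall>n::nat. infdist (x n - x 0) ((\<lambda>v. real n *\<^sub>R v) ` rot_set F)
            \<le> 16 / (pi * eps ^ 2) * (osc F + 2) + eps))
    \<and> (\<forall>x. (\<forall>i. x (Suc i) = F (x i)) \<longrightarrow>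
         (\<forall>n::nat. infdist (x n - x 0) ((\<lambda>v. real n *\<^sub>R v) ` rot_set F)
            \<le> 4 / (pi * eps ^ 2) * (osc F + 1) + eps))"
proof -
  have FL: "torus_lift F" using assms(1) by (simp add: inH_def)
  \<comment> \<open>For pseudo-orbits \<open>eps\<close> is split evenly,
    \<open>d = e = eps / 2\<close>; halving \<open>d\<close> turns the packing constant 4 into
    16.\<close>
  have pseudo: "\<exists>w\<in>rot_set F. norm (x n - x 0 - real n *\<^sub>R w) \<le> 16 / (pi * eps\<^sup>2) * (osc F + 1)"
    if "pseudo_orbit_upto F (eps / 2) n x" for n x
  proof -
    have "4 / (pi * (eps / 2)\<^sup>2) = 16 / (pi * eps\<^sup>2)" by (simp add: power_divide)
    then show ?thesis
      using rot_set_deviation[OF assms(1,4,2,3), of "eps / 2" "eps / 2" n x] that assms(2)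
      by (simp add: pseudo_orbit_upto_def)
  qed
  have infd: "infdist y ((\<lambda>v. real n *\<^sub>R v) ` rot_set F) \<le> B"
    if "\<exists>w\<in>rot_set F. norm (y - real n *\<^sub>R w) \<le> B" for y n B
    using that by (auto simp: dist_norm intro: infdist_le2)
  have 1: "pseudo_rot_set (eps / 2) F = rot_set F"
    using pseudo_rot_set_subset_if_bounded_deviation[OF closed_rot_set[OF FL] pseudo]
      rot_set_subset_pseudo_rot_set[of "eps / 2" F] assms(2) by auto
  have 2: "infdist (x n - x 0) ((\<lambda>v. real n *\<^sub>R v) ` rot_set F) \<le> 16 / (pi * eps ^ 2) * (osc F + 2) + eps"
    if x: "pseudo_orbit F (eps / 2) x" for x n
  proof -
    have "infdist (x n - x 0) ((\<lambda>v. real n *\<^sub>R v) ` rot_set F) \<le> 16 / (pi * eps\<^sup>2) * (osc F + 1)"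
      using pseudo[of n x] x by (intro infd) (simp add: pseudo_orbit_def pseudo_orbit_upto_def)
    also have "\<dots> \<le> 16 / (pi * eps\<^sup>2) * (osc F + 2)" by (intro mult_left_mono) auto
    finally show ?thesis using assms(2) by simp
  qed
  have 3: "infdist (x n - x 0) ((\<lambda>v. real n *\<^sub>R v) ` rot_set F) \<le> 4 / (pi * eps ^ 2) * (osc F + 1) + eps"
    if x: "\<forall>i. x (Suc i) = F (x i)" for x n
  proof -
    \<comment> \<open>A true orbit has no jumps, so all of \<open>eps\<close> is available for
      closing loops: \<open>d = eps\<close> and \<open>e = 0\<close>.\<close>
    have "infdist (x n - x 0) ((\<lambda>v. real n *\<^sub>R v) ` rot_set F) \<le> 4 / (pi * eps\<^sup>2) * (osc F + 1)"
      using rot_set_deviation[OF assms(1,4,2,3), of eps 0 n x] x assms(2) by (intro infd) simp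
    then show ?thesis using assms(2) by simp
  qed
  show ?thesis using 1 2 3 by blast
qed

end
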